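(* Let $\mathcal V$ be a closed monoidal category and $\mathcal C$ an oplax tensored $\mathcal V$-category. Then the completion $\overline{\mathcal C}$ is a tensored $\mathcal V$-category.
   Context: Conventions: composition is written left to right; tensor products in $\mathcal V$ are juxtaposition; associators and unitors are suppressed; "mate" means the morphism corresponding under the indicated adjunction. A $\mathcal V$-category $\mathcal C$ has hom objects $\mathcal C(a\to b)\in\mathcal V$, identities $j_a:1_{\mathcal V}\to\mathcal C(a\to a)$ and composition $-\circ_{\mathcal C}-:\mathcal C(a\to b)\mathcal C(b\to c)\to\mathcal C(a\to c)$, associative and unital. A $\mathcal V$-functor $F$ has morphisms $F_{a\to b}:\mathcal C(a\to b)\to\mathcal D(F(a)\to F(b))$ compatible with composition and identities. The underlying category $\mathcal C^{\mathcal V}$ has the same objects as $\mathcal C$, $\mathcal C^{\mathcal V}(a\to b)=\mathcal V(1_{\mathcal V}\to\mathcal C(a\to b))$, and composition $f\circ g=(fg)\circ(-\circ_{\mathcal C}-)$. $\mathcal C$ is oplax tensored if for every $a\in\mathcal C$ the functor $\mathcal C^{\mathcal V}\to\mathcal V$ given by $b\mapsto\mathcal C(a\to b)$ and $f\in\mathcal C^{\mathcal V}(b\to c)\mapsto(\mathrm{id}_{\mathcal C(a\to b)}f)\circ(-\circ_{\mathcal C}-)$ has a left adjoint. $\mathcal V$ closed: internal homs satisfy $\mathcal V(uw\to v)\cong\mathcal V(w\to\widehat{\mathcal V}(u\to v))$, with $\varepsilon^{\widehat{\mathcal V}}_{u\to v}:u\widehat{\mathcal V}(u\to v)\to v$ the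 mate of the identity. $\widehat{\mathcal V}$ is the self-enriched $\mathcal V$-category, with composition the mate of $(\varepsilon^{\widehat{\mathcal V}}_{u\to v}\mathrm{id})\circ\varepsilon^{\widehat{\mathcal V}}_{v\to w}$. For a $\mathcal V$-category $\mathcal D$ and $a\in\mathcal D$, $\mathcal R^a=\mathcal D(a\to-):\mathcal D\to\widehat{\mathcal V}$ is the $\mathcal V$-functor $b\mapsto\mathcal D(a\to b)$ with action $\mathcal D(b\to c)\to\widehat{\mathcal V}(\mathcal D(a\to b)\to\mathcal D(a\to c))$ the mate of $-\circ_{\mathcal D}-$. $\mathcal D$ is tensored if each $\mathcal R^a$ has a left $\mathcal V$-adjoint, where $L\dashv_{\mathcal V}R$ ($L:\mathcal A\to\mathcal B$, $R:\mathcal B\to\mathcal A$) means there are isomorphisms $\theta_{a,d}:\mathcal B(L(a)\to d)\to\mathcal A(a\to R(d))$ in $\mathcal V$ with $(-\circ_{\mathcal A}-)\circ\theta^{-1}_{a,d}=(L_{a\to b}\theta_{b,d}^{-1})\circ(-\circ_{\mathcal B}-)$ on $\mathcal A(a\to b)\mathcal A(b\to R(d))$ and $(-\circ_{\mathcal B}-)\circ\theta_{a,d}=(\theta_{a,c}R_{c\to d})\circ(-\circ_{\mathcal A}-)$ on $\mathcal B(L(a)\to c)\mathcal B(c\to d)$. Completion: $\overline{\mathcal C}$ is the $\mathcal V$-category with objects formal symbols $a\blacktriangleleft u$ ($a\in\mathcal C$, $u\in\mathcal V$), hom objects $\overline{\mathcal C}(a\blacktriangleleft u\to b\blacktriangleleft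 v)=\widehat{\mathcal V}(u\to\mathcal C(a\to b)v)$, identity $j_{a\blacktriangleleft u}$ the mate of $j_a\mathrm{id}_u\in\mathcal V(u\to\mathcal C(a\to a)u)$, and composition the mate of $(\varepsilon^{\widehat{\mathcal V}}_{u\to\mathcal C(a\to b)v}\mathrm{id})\circ(\mathrm{id}_{\mathcal C(a\to b)}\varepsilon^{\widehat{\mathcal V}}_{v\to\mathcal C(b\to c)w})\circ((-\circ_{\mathcal C}-)\mathrm{id}_w)$. *)

theory Defs
  imports Main
begin

text \<open>
  Composition is written from left to right throughout.
  Categories are records with explicit carriers for objects and arrows; every arrow has one domain
  and one codomain, so composition and the tensor product of arrows need no object indices.
\<close>

section \<open>Categories, functors, adjunctions\<close>

record ('o, 'm) cat =
  Obj :: "'o set"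
  Arr :: "'m set"
  Dom :: "'m \<Rightarrow> 'o"
  Cod :: "'m \<Rightarrow> 'o"
  Ident :: "'o \<Rightarrow> 'm"  ("\<one>\<index>")
  Comp :: "'m \<Rightarrow> 'm \<Rightarrow> 'm"  (infixl "\<cdot>\<index>" 60)

definition Hom :: "('o, 'm, 'z) cat_scheme \<Rightarrow> 'o \<Rightarrow> 'o \<Rightarrow> 'm set" where
  "Hom X a b = {f \<in> Arr X. Dom X f = a \<and> Cod X f = b}"

locale category =
  fixes X :: "('o, 'm, 'z) cat_scheme" (structure)
  assumes Dom_obj: "f \<in> Arr X \<Longrightarrow> Dom X f \<in> Obj X"
    and Cod_obj: "f \<in> Arr X \<Longrightarrow> Cod X f \<in> Obj X"
    and Ident_hom: "a \<in> Obj X \<Longrightarrow> \<one> a \<in> Hom X a a"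
    and Comp_hom: "\<lbrakk>f \<in> Hom X a b; g \<in> Hom X b c\<rbrakk> \<Longrightarrow> f \<cdot> g \<in> Hom X a c"
    and Ident_Comp: "f \<in> Hom X a b \<Longrightarrow> \<one> a \<cdot> f = f"
    and Comp_Ident: "f \<in> Hom X a b \<Longrightarrow> f \<cdot> \<one> b = f"
    and Comp_assoc: "\<lbrakk>f \<in> Hom X a b; g \<in> Hom X b c; h \<in> Hom X c d\<rbrakk>
                      \<Longrightarrow> (f \<cdot> g) \<cdot> h = f \<cdot> (g \<cdot> h)"

definition inverse_arrows :: "('o, 'm, 'z) cat_scheme \<Rightarrow> 'm \<Rightarrow> 'm \<Rightarrow> bool" where
  "inverse_arrows X f g \<longleftrightarrow>
     f \<in> Arr X \<and> g \<in> Hom X (Cod X f) (Dom X f) \<and>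
     f \<cdot>\<^bsub>X\<^esub> g = \<one>\<^bsub>X\<^esub> (Dom X f) \<and> g \<cdot>\<^bsub>X\<^esub> f = \<one>\<^bsub>X\<^esub> (Cod X f)"

definition iso_arr :: "('o, 'm, 'z) cat_scheme \<Rightarrow> 'm \<Rightarrow> bool" where
  "iso_arr X f \<longleftrightarrow> (\<exists>g. inverse_arrows X f g)"

definition inv_arr :: "('o, 'm, 'z) cat_scheme \<Rightarrow> 'm \<Rightarrow> 'm" where
  "inv_arr X f = (THE g. inverse_arrows X f g)"

record ('a, 'f, 'b, 'g) cfunctor =
  FObj :: "'a \<Rightarrow> 'b"
  FArr :: "'f \<Rightarrow> 'g"

locale cat_functor = X: category X + Y: category Y
  for X :: "('a, 'f, 'x) cat_scheme"
    and Y :: "('b, 'g, 'y) cat_scheme"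
    and F :: "('a, 'f, 'b, 'g) cfunctor" +
  assumes FObj_obj: "a \<in> Obj X \<Longrightarrow> FObj F a \<in> Obj Y"
    and FArr_hom: "f \<in> Hom X a b \<Longrightarrow> FArr F f \<in> Hom Y (FObj F a) (FObj F b)"
    and FArr_Ident: "a \<in> Obj X \<Longrightarrow> FArr F (\<one>\<^bsub>X\<^esub> a) = \<one>\<^bsub>Y\<^esub> (FObj F a)"
    and FArr_Comp: "\<lbrakk>f \<in> Hom X a b; g \<in> Hom X b c\<rbrakk>
                     \<Longrightarrow> FArr F (f \<cdot>\<^bsub>X\<^esub> g) = FArr F f \<cdot>\<^bsub>Y\<^esub> FArr F g"

locale adjunction = F: cat_functor Y X F + G: cat_functor X Y G
  for X :: "('a, 'f, 'x) cat_scheme"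
    and Y :: "('b, 'g, 'y) cat_scheme"
    and F :: "('b, 'g, 'a, 'f) cfunctor"
    and G :: "('a, 'f, 'b, 'g) cfunctor" +
  fixes \<phi> :: "'b \<Rightarrow> 'a \<Rightarrow> 'f \<Rightarrow> 'g"
  assumes bij: "\<lbrakk>y \<in> Obj Y; x \<in> Obj X\<rbrakk>
                 \<Longrightarrow> bij_betw (\<phi> y x) (Hom X (FObj F y) x) (Hom Y y (FObj G x))"
    and natural_left: "\<lbrakk>g \<in> Hom Y y' y; f \<in> Hom X (FObj F y) x\<rbrakk>
                 \<Longrightarrow> \<phi> y' x (FArr F g \<cdot>\<^bsub>X\<^esub> f) = g \<cdot>\<^bsub>Y\<^esub> \<phi> y x f"
    and natural_right: "\<lbrakk>y \<in> Obj Y; f \<in> Hom X (FObj F y) x; h \<in> Hom X x x'\<rbrakk>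
                 \<Longrightarrow> \<phi> y x' (f \<cdot>\<^bsub>X\<^esub> h) = \<phi> y x f \<cdot>\<^bsub>Y\<^esub> FArr G h"

definition has_left_adjoint ::
  "('a, 'f, 'x) cat_scheme \<Rightarrow> ('b, 'g, 'y) cat_scheme \<Rightarrow> ('a, 'f, 'b, 'g) cfunctor \<Rightarrow> bool" where
  "has_left_adjoint X Y G \<longleftrightarrow> (\<exists>F \<phi>. adjunction X Y F G \<phi>)"


section \<open>Closed monoidal categories\<close>

record ('o, 'm) moncat = "('o, 'm) cat" +
  TObj :: "'o \<Rightarrow> 'o \<Rightarrow> 'o"  (infixl "\<odot>\<index>" 70)
  TArr :: "'m \<Rightarrow> 'm \<Rightarrow> 'm"  (infixl "\<otimes>\<index>" 70)
  TUnit :: "'o"  ("\<I>\<index>")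
  Assoc :: "'o \<Rightarrow> 'o \<Rightarrow> 'o \<Rightarrow> 'm"  ("\<alpha>\<index>")
  LUnit :: "'o \<Rightarrow> 'm"  ("\<l>\<index>")
  RUnit :: "'o \<Rightarrow> 'm"  ("\<r>\<index>")

locale monoidal_category = category V
  for V :: "('o, 'm, 'z) moncat_scheme" (structure) +
  assumes TObj_obj: "\<lbrakk>u \<in> Obj V; v \<in> Obj V\<rbrakk> \<Longrightarrow> u \<odot> v \<in> Obj V"
    and TUnit_obj: "\<I> \<in> Obj V"
    and TArr_hom: "\<lbrakk>f \<in> Hom V u u'; g \<in> Hom V v v'\<rbrakk> \<Longrightarrow> f \<otimes> g \<in> Hom V (u \<odot> v) (u' \<odot> v')"
    and TArr_Ident: "\<lbrakk>u \<in> Obj V; v \<in> Obj V\<rbrakk> \<Longrightarrow> \<one> u \<otimes> \<one> v = \<one> (u \<odot> v)"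
    and TArr_Comp: "\<lbrakk>f \<in> Hom V u u'; f' \<in> Hom V u' u''; g \<in> Hom V v v'; g' \<in> Hom V v' v''\<rbrakk>
          \<Longrightarrow> (f \<cdot> f') \<otimes> (g \<cdot> g') = (f \<otimes> g) \<cdot> (f' \<otimes> g')"
    and Assoc_hom: "\<lbrakk>u \<in> Obj V; v \<in> Obj V; w \<in> Obj V\<rbrakk>
          \<Longrightarrow> \<alpha> u v w \<in> Hom V ((u \<odot> v) \<odot> w) (u \<odot> (v \<odot> w))"
    and Assoc_iso: "\<lbrakk>u \<in> Obj V; v \<in> Obj V; w \<in> Obj V\<rbrakk> \<Longrightarrow> iso_arr V (\<alpha> u v w)"
    and Assoc_natural: "\<lbrakk>f \<in> Hom V u u'; g \<in> Hom V v v'; h \<in> Hom V w w'\<rbrakk>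
          \<Longrightarrow> ((f \<otimes> g) \<otimes> h) \<cdot> \<alpha> u' v' w' = \<alpha> u v w \<cdot> (f \<otimes> (g \<otimes> h))"
    and LUnit_hom: "u \<in> Obj V \<Longrightarrow> \<l> u \<in> Hom V (\<I> \<odot> u) u"
    and LUnit_iso: "u \<in> Obj V \<Longrightarrow> iso_arr V (\<l> u)"
    and LUnit_natural: "f \<in> Hom V u u' \<Longrightarrow> (\<one> \<I> \<otimes> f) \<cdot> \<l> u' = \<l> u \<cdot> f"
    and RUnit_hom: "u \<in> Obj V \<Longrightarrow> \<r> u \<in> Hom V (u \<odot> \<I>) u"
    and RUnit_iso: "u \<in> Obj V \<Longrightarrow> iso_arr V (\<r> u)"
    and RUnit_natural: "f \<in> Hom V u u' \<Longrightarrow> (f \<otimes> \<one> \<I>) \<cdot> \<r> u' = \<r> u \<cdot> f"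
    and triangle: "\<lbrakk>u \<in> Obj V; v \<in> Obj V\<rbrakk> \<Longrightarrow> \<alpha> u \<I> v \<cdot> (\<one> u \<otimes> \<l> v) = \<r> u \<otimes> \<one> v"
    and pentagon: "\<lbrakk>t \<in> Obj V; u \<in> Obj V; v \<in> Obj V; w \<in> Obj V\<rbrakk>
          \<Longrightarrow> (\<alpha> t u v \<otimes> \<one> w) \<cdot> \<alpha> t (u \<odot> v) w \<cdot> (\<one> t \<otimes> \<alpha> u v w)
              = \<alpha> (t \<odot> u) v w \<cdot> \<alpha> t u (v \<odot> w)"

text \<open>
  \<open>Mate V u w v\<close> is the bijection from \<open>Hom V (u \<odot> w) v\<close> to \<open>Hom V w (IHom V u v)\<close>, i.e. the
  adjunction has \<open>u \<odot> -\<close> (tensoring on the left) as left adjoint; no braiding is assumed.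
  Naturality in \<open>w\<close> makes \<open>IHom V u v\<close> a representing object; functoriality of \<open>IHom V u\<close> and
  naturality in \<open>v\<close> are then determined and need not be postulated.
\<close>

record ('o, 'm) closed_moncat = "('o, 'm) moncat" +
  IHom :: "'o \<Rightarrow> 'o \<Rightarrow> 'o"
  Mate :: "'o \<Rightarrow> 'o \<Rightarrow> 'o \<Rightarrow> 'm \<Rightarrow> 'm"

locale closed_monoidal_category = monoidal_category V
  for V :: "('o, 'm, 'z) closed_moncat_scheme" (structure) +
  assumes IHom_obj: "\<lbrakk>u \<in> Obj V; v \<in> Obj V\<rbrakk> \<Longrightarrow> IHom V u v \<in> Obj V"
    and Mate_bij: "\<lbrakk>u \<in> Obj V; w \<in> Obj V; v \<in> Obj V\<rbrakk>
          \<Longrightarrow> bij_betw (Mate V u w v) (Hom V (u \<odot> w) v) (Hom V w (IHom V u v))"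
    and Mate_natural: "\<lbrakk>u \<in> Obj V; g \<in> Hom V w' w; f \<in> Hom V (u \<odot> w) v\<rbrakk>
          \<Longrightarrow> Mate V u w' v ((\<one> u \<otimes> g) \<cdot> f) = g \<cdot> Mate V u w v f"

definition IEval :: "('o, 'm, 'z) closed_moncat_scheme \<Rightarrow> 'o \<Rightarrow> 'o \<Rightarrow> 'm"  ("\<epsilon>\<index>") where
  "\<epsilon>\<^bsub>V\<^esub> u v =
     inv_into (Hom V (u \<odot>\<^bsub>V\<^esub> IHom V u v) v) (Mate V u (IHom V u v) v) (\<one>\<^bsub>V\<^esub> (IHom V u v))"


section \<open>Enriched categories\<close>

record ('a, 'o, 'm) vcat =
  VObj :: "'a set"
  VHom :: "'a \<Rightarrow> 'a \<Rightarrow> 'o"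
  VId :: "'a \<Rightarrow> 'm"
  VComp :: "'a \<Rightarrow> 'a \<Rightarrow> 'a \<Rightarrow> 'm"

locale V_category = monoidal_category V
  for V :: "('o, 'm, 'z) moncat_scheme" (structure) +
  fixes C :: "('a, 'o, 'm) vcat"
  assumes VHom_obj: "\<lbrakk>a \<in> VObj C; b \<in> VObj C\<rbrakk> \<Longrightarrow> VHom C a b \<in> Obj V"
    and VId_hom: "a \<in> VObj C \<Longrightarrow> VId C a \<in> Hom V \<I> (VHom C a a)"
    and VComp_hom: "\<lbrakk>a \<in> VObj C; b \<in> VObj C; c \<in> VObj C\<rbrakk>
          \<Longrightarrow> VComp C a b c \<in> Hom V (VHom C a b \<odot> VHom C b c) (VHom C a c)"
    and VComp_assoc: "\<lbrakk>a \<in> VObj C; b \<in> VObj C; c \<in> VObj C; d \<in> VObj C\<rbrakk>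
          \<Longrightarrow> (VComp C a b c \<otimes> \<one> (VHom C c d)) \<cdot> VComp C a c d
              = \<alpha> (VHom C a b) (VHom C b c) (VHom C c d)
                \<cdot> (\<one> (VHom C a b) \<otimes> VComp C b c d) \<cdot> VComp C a b d"
    and VId_VComp: "\<lbrakk>a \<in> VObj C; b \<in> VObj C\<rbrakk>
          \<Longrightarrow> (VId C a \<otimes> \<one> (VHom C a b)) \<cdot> VComp C a a b = \<l> (VHom C a b)"
    and VComp_VId: "\<lbrakk>a \<in> VObj C; b \<in> VObj C\<rbrakk>
          \<Longrightarrow> (\<one> (VHom C a b) \<otimes> VId C b) \<cdot> VComp C a b b = \<r> (VHom C a b)"

record ('a, 'b, 'm) vfunctor =
  VFObj :: "'a \<Rightarrow> 'b"
  VFArr :: "'a \<Rightarrow> 'a \<Rightarrow> 'm"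

locale V_functor = A: V_category V A + B: V_category V B
  for V :: "('o, 'm, 'z) moncat_scheme" (structure)
    and A :: "('a, 'o, 'm) vcat"
    and B :: "('b, 'o, 'm) vcat"
    and F :: "('a, 'b, 'm) vfunctor" +
  assumes VFObj_obj: "a \<in> VObj A \<Longrightarrow> VFObj F a \<in> VObj B"
    and VFArr_hom: "\<lbrakk>a \<in> VObj A; b \<in> VObj A\<rbrakk>
          \<Longrightarrow> VFArr F a b \<in> Hom V (VHom A a b) (VHom B (VFObj F a) (VFObj F b))"
    and VFArr_VId: "a \<in> VObj A \<Longrightarrow> VId A a \<cdot> VFArr F a a = VId B (VFObj F a)"
    and VFArr_VComp: "\<lbrakk>a \<in> VObj A; b \<in> VObj A; c \<in> VObj A\<rbrakk>
          \<Longrightarrow> VComp A a b c \<cdot> VFArr F a c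
              = (VFArr F a b \<otimes> VFArr F b c) \<cdot> VComp B (VFObj F a) (VFObj F b) (VFObj F c)"

locale V_adjunction = L: V_functor V A B L + R: V_functor V B A R
  for V :: "('o, 'm, 'z) moncat_scheme" (structure)
    and A :: "('a, 'o, 'm) vcat"
    and B :: "('b, 'o, 'm) vcat"
    and L :: "('a, 'b, 'm) vfunctor"
    and R :: "('b, 'a, 'm) vfunctor" +
  fixes \<theta> :: "'a \<Rightarrow> 'b \<Rightarrow> 'm"
  assumes \<theta>_hom: "\<lbrakk>a \<in> VObj A; d \<in> VObj B\<rbrakk>
          \<Longrightarrow> \<theta> a d \<in> Hom V (VHom B (VFObj L a) d) (VHom A a (VFObj R d))"
    and \<theta>_iso: "\<lbrakk>a \<in> VObj A; d \<in> VObj B\<rbrakk> \<Longrightarrow> iso_arr V (\<theta> a d)"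
    and \<theta>_left: "\<lbrakk>a \<in> VObj A; b \<in> VObj A; d \<in> VObj B\<rbrakk>
          \<Longrightarrow> VComp A a b (VFObj R d) \<cdot> inv_arr V (\<theta> a d)
              = (VFArr L a b \<otimes> inv_arr V (\<theta> b d)) \<cdot> VComp B (VFObj L a) (VFObj L b) d"
    and \<theta>_right: "\<lbrakk>a \<in> VObj A; c \<in> VObj B; d \<in> VObj B\<rbrakk>
          \<Longrightarrow> VComp B (VFObj L a) c d \<cdot> \<theta> a d
              = (\<theta> a c \<otimes> VFArr R c d) \<cdot> VComp A a (VFObj R c) (VFObj R d)"

definition has_left_V_adjoint ::
  "('o, 'm, 'z) moncat_scheme \<Rightarrow> ('a, 'o, 'm) vcat \<Rightarrow> ('b, 'o, 'm) vcat
    \<Rightarrow> ('b, 'a, 'm) vfunctor \<Rightarrow> bool" where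
  "has_left_V_adjoint V A B R \<longleftrightarrow> (\<exists>L \<theta>. V_adjunction V A B L R \<theta>)"


section \<open>Oplax tensored enriched categories\<close>

text \<open>
  Arrows \<open>a \<rightarrow> b\<close> of the underlying category are arrows \<open>f : \<I> \<rightarrow> VHom C a b\<close> of \<open>V\<close>, tagged with
  \<open>a\<close> and \<open>b\<close> because distinct pairs of objects may have the same hom object.
\<close>

definition underlying ::
  "('o, 'm, 'z) moncat_scheme \<Rightarrow> ('a, 'o, 'm) vcat \<Rightarrow> ('a, 'a \<times> 'm \<times> 'a) cat" where
  "underlying V C =
    \<lparr> Obj = VObj C,
      Arr = {(a, f, b). a \<in> VObj C \<and> b \<in> VObj C \<and> f \<in> Hom V \<I>\<^bsub>V\<^esub> (VHom C a b)},
      Dom = (\<lambda>(a, f, b). a),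
      Cod = (\<lambda>(a, f, b). b),
      Ident = (\<lambda>a. (a, VId C a, a)),
      Comp = (\<lambda>(a, f, b) (b', g, c).
        (a, inv_arr V (\<l>\<^bsub>V\<^esub> \<I>\<^bsub>V\<^esub>) \<cdot>\<^bsub>V\<^esub> (f \<otimes>\<^bsub>V\<^esub> g) \<cdot>\<^bsub>V\<^esub> VComp C a b c, c)) \<rparr>"

definition underlying_hom_functor ::
  "('o, 'm, 'z) moncat_scheme \<Rightarrow> ('a, 'o, 'm) vcat \<Rightarrow> 'a
    \<Rightarrow> ('a, 'a \<times> 'm \<times> 'a, 'o, 'm) cfunctor" where
  "underlying_hom_functor V C a =
    \<lparr> FObj = (\<lambda>b. VHom C a b),
      FArr = (\<lambda>(b, f, c). inv_arr V (\<r>\<^bsub>V\<^esub> (VHom C a b))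
        \<cdot>\<^bsub>V\<^esub> (\<one>\<^bsub>V\<^esub> (VHom C a b) \<otimes>\<^bsub>V\<^esub> f) \<cdot>\<^bsub>V\<^esub> VComp C a b c) \<rparr>"

locale oplax_tensored_V_category = V_category V C
  for V :: "('o, 'm, 'z) moncat_scheme" (structure)
    and C :: "('a, 'o, 'm) vcat" +
  assumes oplax_tensored:
    "a \<in> VObj C \<Longrightarrow> has_left_adjoint (underlying V C) V (underlying_hom_functor V C a)"


section \<open>Tensored enriched categories\<close>

definition self_enrichment :: "('o, 'm, 'z) closed_moncat_scheme \<Rightarrow> ('o, 'o, 'm) vcat" where
  "self_enrichment V =
    \<lparr> VObj = Obj V,
      VHom = IHom V,
      VId = (\<lambda>u. Mate V u \<I>\<^bsub>V\<^esub> u (\<r>\<^bsub>V\<^esub> u)),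
      VComp = (\<lambda>u v w. Mate V u (IHom V u v \<odot>\<^bsub>V\<^esub> IHom V v w) w
        (inv_arr V (\<alpha>\<^bsub>V\<^esub> u (IHom V u v) (IHom V v w))
         \<cdot>\<^bsub>V\<^esub> (\<epsilon>\<^bsub>V\<^esub> u v \<otimes>\<^bsub>V\<^esub> \<one>\<^bsub>V\<^esub> (IHom V v w))
         \<cdot>\<^bsub>V\<^esub> \<epsilon>\<^bsub>V\<^esub> v w)) \<rparr>"

definition representable ::
  "('o, 'm, 'z) closed_moncat_scheme \<Rightarrow> ('a, 'o, 'm) vcat \<Rightarrow> 'a \<Rightarrow> ('a, 'o, 'm) vfunctor" where
  "representable V D a =
    \<lparr> VFObj = (\<lambda>b. VHom D a b),
      VFArr = (\<lambda>b c. Mate V (VHom D a b) (VHom D b c) (VHom D a c) (VComp D a b c)) \<rparr>"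

locale tensored_V_category = closed_monoidal_category V + V_category V D
  for V :: "('o, 'm, 'z) closed_moncat_scheme" (structure)
    and D :: "('a, 'o, 'm) vcat" +
  assumes tensored:
    "a \<in> VObj D \<Longrightarrow> has_left_V_adjoint V (self_enrichment V) D (representable V D a)"


section \<open>The completion\<close>

datatype ('a, 'o) formal_tensor = FormalTensor 'a 'o  (infix "\<lhd>" 75)

text \<open>
  The mate of \<open>VId C a \<otimes> \<one> u : u \<rightarrow> VHom C a a \<odot> u\<close> is taken under \<open>u \<cong> u \<odot> \<I>\<close>; the unit
  isomorphisms and associators below are the ones suppressed in the strict notation.
\<close>

definition completion ::
  "('o, 'm, 'z) closed_moncat_scheme \<Rightarrow> ('a, 'o, 'm) vcat
    \<Rightarrow> (('a, 'o) formal_tensor, 'o, 'm) vcat" where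
  "completion V C =
    \<lparr> VObj = {a \<lhd> u | a u. a \<in> VObj C \<and> u \<in> Obj V},
      VHom = (\<lambda>x y. case (x, y) of (a \<lhd> u, b \<lhd> v) \<Rightarrow> IHom V u (VHom C a b \<odot>\<^bsub>V\<^esub> v)),
      VId = (\<lambda>x. case x of a \<lhd> u \<Rightarrow>
        Mate V u \<I>\<^bsub>V\<^esub> (VHom C a a \<odot>\<^bsub>V\<^esub> u)
          (\<r>\<^bsub>V\<^esub> u \<cdot>\<^bsub>V\<^esub> inv_arr V (\<l>\<^bsub>V\<^esub> u) \<cdot>\<^bsub>V\<^esub> (VId C a \<otimes>\<^bsub>V\<^esub> \<one>\<^bsub>V\<^esub> u))),
      VComp = (\<lambda>x y z. case (x, y, z) of (a \<lhd> u, b \<lhd> v, c \<lhd> w) \<Rightarrow>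
        let ab = VHom C a b; bc = VHom C b c;
            h = IHom V u (ab \<odot>\<^bsub>V\<^esub> v); k = IHom V v (bc \<odot>\<^bsub>V\<^esub> w)
        in Mate V u (h \<odot>\<^bsub>V\<^esub> k) (VHom C a c \<odot>\<^bsub>V\<^esub> w)
          (inv_arr V (\<alpha>\<^bsub>V\<^esub> u h k)
           \<cdot>\<^bsub>V\<^esub> (\<epsilon>\<^bsub>V\<^esub> u (ab \<odot>\<^bsub>V\<^esub> v) \<otimes>\<^bsub>V\<^esub> \<one>\<^bsub>V\<^esub> k)
           \<cdot>\<^bsub>V\<^esub> \<alpha>\<^bsub>V\<^esub> ab v k
           \<cdot>\<^bsub>V\<^esub> (\<one>\<^bsub>V\<^esub> ab \<otimes>\<^bsub>V\<^esub> \<epsilon>\<^bsub>V\<^esub> v (bc \<odot>\<^bsub>V\<^esub> w))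
           \<cdot>\<^bsub>V\<^esub> inv_arr V (\<alpha>\<^bsub>V\<^esub> ab bc w)
           \<cdot>\<^bsub>V\<^esub> (VComp C a b c \<otimes>\<^bsub>V\<^esub> \<one>\<^bsub>V\<^esub> w))) \<rparr>"

end

(* The tensor of w with a <| u is a <| (u w). The hom objects of the completion are internal homs
   out of the second component, so the required isomorphism from [u w, C(a,b) v] to
   [w, [u, C(a,b) v]] is currying, which exists in any closed monoidal category. The action
   [w,w'] -> [u w, C(a,a) (u w')] of the left adjoint evaluates in w and inserts the identity of a.
   Equations between morphisms into an internal hom are checked after evaluation; there composition
   becomes composition of parametrised morphisms, and everything reduces to the axioms of C and
   Mac Lane coherence, including Kelly's two derived unit triangles. *)
theory Submission
  imports Defs
begin

section \<open>Monoidal coherence\<close>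

text \<open>Checking after evaluation is legitimate because \<open>Mate\<close> is bijective and
  natural in the parameter, so a morphism into [u,v] can be recovered from its transpose. The
  obstacle is that associators and unitors are not strict, and transposed composites become long
  words in \<alpha> and its inverse. Three operations absorb them: \<open>tri\<close> composes
  parametrised arrows, \<open>whisk\<close> carries a factor along, and \<open>act\<close> composes
  in \<open>C\<close> with an object of \<open>V\<close> attached. Beyond the derived unit
  triangles, the pentagon enters only through the laws relating these three; the enriched statements
  follow from the laws with no further use of the pentagon. The isomorphism of the adjunction
  depends on b \<lhd> v only through X = C(a,b) v, so currying is treated for arbitrary X. Its
  inverse is itself a transpose over u w, hence the law stated with the inverse needs a single
  evaluation, whereas the other law compares morphisms into [w,[u,X]] and needs two.\<close>

context category
begin

lemma Arr_Comp [simp]: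
  "\<lbrakk>f \<in> Arr X; g \<in> Arr X; Cod X f = Dom X g\<rbrakk> \<Longrightarrow> f \<cdot> g \<in> Arr X"
  and Dom_Comp [simp]:
  "\<lbrakk>f \<in> Arr X; g \<in> Arr X; Cod X f = Dom X g\<rbrakk> \<Longrightarrow> Dom X (f \<cdot> g) = Dom X f"
  and Cod_Comp [simp]:
  "\<lbrakk>f \<in> Arr X; g \<in> Arr X; Cod X f = Dom X g\<rbrakk> \<Longrightarrow> Cod X (f \<cdot> g) = Cod X g"
  using Comp_hom[of f "Dom X f" "Cod X f" g "Cod X g"] by (auto simp: Hom_def)

lemma Comp_assoc_Arr [simp]:
  "\<lbrakk>f \<in> Arr X; g \<in> Arr X; h \<in> Arr X; Cod X f = Dom X g; Cod X g = Dom X h\<rbrakk>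
    \<Longrightarrow> (f \<cdot> g) \<cdot> h = f \<cdot> (g \<cdot> h)"
  using Comp_assoc[of f "Dom X f" "Cod X f" g "Cod X g" h "Cod X h"] by (auto simp: Hom_def)

lemma Ident_simps [simp]:
  "a \<in> Obj X \<Longrightarrow> \<one> a \<in> Arr X"
  "a \<in> Obj X \<Longrightarrow> Dom X (\<one> a) = a"
  "a \<in> Obj X \<Longrightarrow> Cod X (\<one> a) = a"
  using Ident_hom[of a] by (auto simp: Hom_def)

lemma Ident_Comp_Arr [simp]: "\<lbrakk>f \<in> Arr X; Dom X f = a\<rbrakk> \<Longrightarrow> \<one> a \<cdot> f = f"
  using Ident_Comp[of f a "Cod X f"] by (auto simp: Hom_def)

lemma Comp_Ident_Arr [simp]: "\<lbrakk>f \<in> Arr X; Cod X f = a\<rbrakk> \<Longrightarrow> f \<cdot> \<one> a = f"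
  using Comp_Ident[of f "Dom X f" a] by (auto simp: Hom_def)

lemmas Dom_Cod_obj [simp] = Dom_obj Cod_obj

text \<open>Composites are kept nested to the right, where an equation for p followed by q does not
  match once a further arrow h comes after them. This gives the form with h attached.\<close>

lemma Comp_extend:
  "\<lbrakk>p \<cdot> q = r; p \<in> Arr X; q \<in> Arr X; h \<in> Arr X; Cod X p = Dom X q; Cod X q = Dom X h\<rbrakk>
    \<Longrightarrow> p \<cdot> (q \<cdot> h) = r \<cdot> h"
  using Comp_assoc_Arr by auto

text \<open>\<open>inv_arr\<close> is a definite description, so uniqueness of inverses is needed
  before it can be used: a second inverse g' equals g' f g, which is g.\<close>

lemma inverse_arrows_inv_arr:
  assumes "iso_arr X f"
  shows "inverse_arrows X f (inv_arr X f)"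
proof -
  obtain g where g: "inverse_arrows X f g"
    using assms by (auto simp: iso_arr_def)
  have "g' = g" if g': "inverse_arrows X f g'" for g'
  proof -
    have "g' = g' \<cdot> (f \<cdot> g)"
      using g g' by (auto simp: inverse_arrows_def Hom_def)
    also have "\<dots> = (g' \<cdot> f) \<cdot> g"
      using g g' by (subst Comp_assoc_Arr) (auto simp: inverse_arrows_def Hom_def)
    also have "\<dots> = g"
      using g g' by (auto simp: inverse_arrows_def Hom_def)
    finally show ?thesis .
  qed
  with g show ?thesis
    unfolding inv_arr_def by (rule theI)
qed

lemma inv_arr_eqI:
  assumes "inverse_arrows X f g"
  shows "inv_arr X f = g"
proof -
  have h: "inverse_arrows X f (inv_arr X f)"
    using assms inverse_arrows_inv_arr by (auto simp: iso_arr_def)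
  have "inv_arr X f = inv_arr X f \<cdot> (f \<cdot> g)"
    using assms h by (auto simp: inverse_arrows_def Hom_def)
  also have "\<dots> = (inv_arr X f \<cdot> f) \<cdot> g"
    using assms h by (subst Comp_assoc_Arr) (auto simp: inverse_arrows_def Hom_def)
  also have "\<dots> = g"
    using assms h by (auto simp: inverse_arrows_def Hom_def)
  finally show ?thesis .
qed

lemma inv_arr_simps:
  assumes "iso_arr X f" "f \<in> Hom X a b"
  shows "inv_arr X f \<in> Arr X" "Dom X (inv_arr X f) = b" "Cod X (inv_arr X f) = a"
    "f \<cdot> inv_arr X f = \<one> a" "inv_arr X f \<cdot> f = \<one> b"
    "\<lbrakk>g \<in> Arr X; Dom X g = a\<rbrakk> \<Longrightarrow> f \<cdot> (inv_arr X f \<cdot> g) = g"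
    "\<lbrakk>g \<in> Arr X; Dom X g = b\<rbrakk> \<Longrightarrow> inv_arr X f \<cdot> (f \<cdot> g) = g"
  using inverse_arrows_inv_arr[OF assms(1)] assms(2)
  by (auto simp: inverse_arrows_def Hom_def Comp_extend)

lemma epi_iso:
  assumes "iso_arr X p" "p \<cdot> f = p \<cdot> g" "f \<in> Arr X" "g \<in> Arr X" "Dom X f = Cod X p" "Dom X g = Cod X p"
  shows "f = g"
proof -
  have p: "p \<in> Hom X (Dom X p) (Cod X p)"
    using inverse_arrows_inv_arr[OF assms(1)] by (auto simp: inverse_arrows_def Hom_def)
  have "f = inv_arr X p \<cdot> (p \<cdot> f)"
    using inv_arr_simps[OF assms(1) p] assms(3-) by simp
  also have "\<dots> = inv_arr X p \<cdot> (p \<cdot> g)"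
    using assms(2) by simp
  also have "\<dots> = g"
    using inv_arr_simps[OF assms(1) p] assms(3-) by simp
  finally show ?thesis .
qed

lemma mono_iso:
  assumes "iso_arr X p" "f \<cdot> p = g \<cdot> p" "f \<in> Arr X" "g \<in> Arr X" "Cod X f = Dom X p" "Cod X g = Dom X p"
  shows "f = g"
proof -
  have p: "p \<in> Hom X (Dom X p) (Cod X p)"
    using inverse_arrows_inv_arr[OF assms(1)] by (auto simp: inverse_arrows_def Hom_def)
  have p': "p \<in> Arr X" using p by (simp add: Hom_def)
  have "f = (f \<cdot> p) \<cdot> inv_arr X p"
    using inv_arr_simps[OF assms(1) p] assms(3-) p' by simp
  also have "\<dots> = (g \<cdot> p) \<cdot> inv_arr X p"
    using assms(2) by simp
  also have "\<dots> = g"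
    using inv_arr_simps[OF assms(1) p] assms(3-) p' by simp
  finally show ?thesis .
qed

end


section \<open>Tensor products of arrows and the structure isomorphisms\<close>

context monoidal_category
begin

lemmas obj_simps [simp] = TObj_obj TUnit_obj

lemma TArr_simps [simp]:
  "\<lbrakk>f \<in> Arr V; g \<in> Arr V\<rbrakk> \<Longrightarrow> f \<otimes> g \<in> Arr V"
  "\<lbrakk>f \<in> Arr V; g \<in> Arr V\<rbrakk> \<Longrightarrow> Dom V (f \<otimes> g) = Dom V f \<odot> Dom V g"
  "\<lbrakk>f \<in> Arr V; g \<in> Arr V\<rbrakk> \<Longrightarrow> Cod V (f \<otimes> g) = Cod V f \<odot> Cod V g"
  using TArr_hom[of f "Dom V f" "Cod V f" g "Dom V g" "Cod V g"] by (auto simp: Hom_def)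

lemmas TArr_Ident' [simp] = TArr_Ident

lemma TArr_Comp_Arr:
  "\<lbrakk>f \<in> Arr V; g \<in> Arr V; f' \<in> Arr V; g' \<in> Arr V; Cod V f = Dom V f'; Cod V g = Dom V g'\<rbrakk>
    \<Longrightarrow> (f \<otimes> g) \<cdot> (f' \<otimes> g') = (f \<cdot> f') \<otimes> (g \<cdot> g')"
  using TArr_Comp[of f "Dom V f" "Cod V f" f' "Cod V f'" g "Dom V g" "Cod V g" g' "Cod V g'"]
  by (auto simp: Hom_def)

lemma TArr_Comp_Arr':
  "\<lbrakk>f \<in> Arr V; g \<in> Arr V; f' \<in> Arr V; g' \<in> Arr V; Cod V f = Dom V f'; Cod V g = Dom V g';
    h \<in> Arr V; Dom V h = Cod V f' \<odot> Cod V g'\<rbrakk>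
    \<Longrightarrow> (f \<otimes> g) \<cdot> ((f' \<otimes> g') \<cdot> h) = ((f \<cdot> f') \<otimes> (g \<cdot> g')) \<cdot> h"
  by (subst Comp_extend[OF TArr_Comp_Arr]) auto

lemmas merge = TArr_Comp_Arr TArr_Comp_Arr'

lemma Ident_TArr_Comp:
  "\<lbrakk>u \<in> Obj V; f \<in> Arr V; g \<in> Arr V; Cod V f = Dom V g\<rbrakk>
    \<Longrightarrow> \<one> u \<otimes> (f \<cdot> g) = (\<one> u \<otimes> f) \<cdot> (\<one> u \<otimes> g)"
  by (simp add: merge)

lemma TArr_Ident_Comp:
  "\<lbrakk>u \<in> Obj V; f \<in> Arr V; g \<in> Arr V; Cod V f = Dom V g\<rbrakk>
    \<Longrightarrow> (f \<cdot> g) \<otimes> \<one> u = (f \<otimes> \<one> u) \<cdot> (g \<otimes> \<one> u)"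
  by (simp add: merge)

text \<open>The interchange law is left out of the default simplification in both directions:
  \<open>merge\<close> contracts two tensors into one, \<open>distr\<close> splits a whiskered
  composite, and each proof chooses the direction it needs.\<close>

lemmas distr = Ident_TArr_Comp TArr_Ident_Comp

lemma iso_TArr_Ident:
  assumes "iso_arr V f" "u \<in> Obj V"
  shows "iso_arr V (f \<otimes> \<one> u)" "iso_arr V (\<one> u \<otimes> f)"
proof -
  have "inverse_arrows V f (inv_arr V f)"
    by (rule inverse_arrows_inv_arr[OF assms(1)])
  then have "inverse_arrows V (f \<otimes> \<one> u) (inv_arr V f \<otimes> \<one> u)"
    "inverse_arrows V (\<one> u \<otimes> f) (\<one> u \<otimes> inv_arr V f)"
    using assms(2) by (auto simp: inverse_arrows_def Hom_def merge)
  then show "iso_arr V (f \<otimes> \<one> u)" "iso_arr V (\<one> u \<otimes> f)"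
    by (auto simp: iso_arr_def)
qed

abbreviation assoc_inv :: "'o \<Rightarrow> 'o \<Rightarrow> 'o \<Rightarrow> 'm"  ("\<alpha>\<^sup>-") where
  "\<alpha>\<^sup>- u v w \<equiv> inv_arr V (\<alpha> u v w)"

abbreviation lunit_inv :: "'o \<Rightarrow> 'm"  ("\<l>\<^sup>-") where
  "\<l>\<^sup>- u \<equiv> inv_arr V (\<l> u)"

lemma structure_simps [simp]:
  assumes "u \<in> Obj V"
  shows "\<l> u \<in> Arr V" "Dom V (\<l> u) = \<I> \<odot> u" "Cod V (\<l> u) = u"
    and "\<r> u \<in> Arr V" "Dom V (\<r> u) = u \<odot> \<I>" "Cod V (\<r> u) = u"
    and "\<lbrakk>v \<in> Obj V; w \<in> Obj V\<rbrakk> \<Longrightarrow> \<alpha> u v w \<in> Arr V"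
    and "\<lbrakk>v \<in> Obj V; w \<in> Obj V\<rbrakk> \<Longrightarrow> Dom V (\<alpha> u v w) = (u \<odot> v) \<odot> w"
    and "\<lbrakk>v \<in> Obj V; w \<in> Obj V\<rbrakk> \<Longrightarrow> Cod V (\<alpha> u v w) = u \<odot> (v \<odot> w)"
  using LUnit_hom[OF assms] RUnit_hom[OF assms] Assoc_hom[OF assms]
  by (auto simp: Hom_def)

lemmas assoc_inv_simps [simp] = inv_arr_simps[OF Assoc_iso Assoc_hom]
lemmas lunit_inv_simps [simp] = inv_arr_simps[OF LUnit_iso LUnit_hom]

lemma whisker_inverse:
  assumes p: "iso_arr V p" "p \<in> Hom V a b" and u: "u \<in> Obj V"
  shows "(\<one> u \<otimes> p) \<cdot> (\<one> u \<otimes> inv_arr V p) = \<one> (u \<odot> a)"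
    and "(\<one> u \<otimes> inv_arr V p) \<cdot> (\<one> u \<otimes> p) = \<one> (u \<odot> b)"
    and "(p \<otimes> \<one> u) \<cdot> (inv_arr V p \<otimes> \<one> u) = \<one> (a \<odot> u)"
    and "(inv_arr V p \<otimes> \<one> u) \<cdot> (p \<otimes> \<one> u) = \<one> (b \<odot> u)"
    and "\<lbrakk>h \<in> Arr V; Dom V h = u \<odot> a\<rbrakk> \<Longrightarrow> (\<one> u \<otimes> p) \<cdot> ((\<one> u \<otimes> inv_arr V p) \<cdot> h) = h"
    and "\<lbrakk>h \<in> Arr V; Dom V h = u \<odot> b\<rbrakk> \<Longrightarrow> (\<one> u \<otimes> inv_arr V p) \<cdot> ((\<one> u \<otimes> p) \<cdot> h) = h"
    and "\<lbrakk>h \<in> Arr V; Dom V h = a \<odot> u\<rbrakk> \<Longrightarrow> (p \<otimes> \<one> u) \<cdot> ((inv_arr V p \<otimes> \<one> u) \<cdot> h) = h"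
    and "\<lbrakk>h \<in> Arr V; Dom V h = b \<odot> u\<rbrakk> \<Longrightarrow> (inv_arr V p \<otimes> \<one> u) \<cdot> ((p \<otimes> \<one> u) \<cdot> h) = h"
proof -
  have "a \<in> Obj V" "b \<in> Obj V" "p \<in> Arr V" "Dom V p = a" "Cod V p = b"
    using p by (auto simp: Hom_def)
  note this [simp] u [simp] inv_arr_simps[OF p, simp]
  show "(\<one> u \<otimes> p) \<cdot> (\<one> u \<otimes> inv_arr V p) = \<one> (u \<odot> a)"
    "(\<one> u \<otimes> inv_arr V p) \<cdot> (\<one> u \<otimes> p) = \<one> (u \<odot> b)"
    "(p \<otimes> \<one> u) \<cdot> (inv_arr V p \<otimes> \<one> u) = \<one> (a \<odot> u)"
    "(inv_arr V p \<otimes> \<one> u) \<cdot> (p \<otimes> \<one> u) = \<one> (b \<odot> u)"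
    "\<lbrakk>h \<in> Arr V; Dom V h = u \<odot> a\<rbrakk> \<Longrightarrow> (\<one> u \<otimes> p) \<cdot> ((\<one> u \<otimes> inv_arr V p) \<cdot> h) = h"
    "\<lbrakk>h \<in> Arr V; Dom V h = u \<odot> b\<rbrakk> \<Longrightarrow> (\<one> u \<otimes> inv_arr V p) \<cdot> ((\<one> u \<otimes> p) \<cdot> h) = h"
    "\<lbrakk>h \<in> Arr V; Dom V h = a \<odot> u\<rbrakk> \<Longrightarrow> (p \<otimes> \<one> u) \<cdot> ((inv_arr V p \<otimes> \<one> u) \<cdot> h) = h"
    "\<lbrakk>h \<in> Arr V; Dom V h = b \<odot> u\<rbrakk> \<Longrightarrow> (inv_arr V p \<otimes> \<one> u) \<cdot> ((p \<otimes> \<one> u) \<cdot> h) = h"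
    by (simp_all add: merge)
qed

lemmas whisker_assoc [simp] = whisker_inverse[OF Assoc_iso Assoc_hom]
lemmas whisker_lunit [simp] = whisker_inverse[OF LUnit_iso LUnit_hom]

lemma Assoc_natural_Arr:
  "\<lbrakk>f \<in> Arr V; g \<in> Arr V; h \<in> Arr V; Cod V f = u'; Cod V g = v'; Cod V h = w'\<rbrakk>
    \<Longrightarrow> ((f \<otimes> g) \<otimes> h) \<cdot> \<alpha> u' v' w' = \<alpha> (Dom V f) (Dom V g) (Dom V h) \<cdot> (f \<otimes> (g \<otimes> h))"
  using Assoc_natural[of f _ _ g _ _ h] by (auto simp: Hom_def)

lemma assoc_inv_natural:
  assumes "f \<in> Arr V" "g \<in> Arr V" "h \<in> Arr V" "Cod V f = u'" "Cod V g = v'" "Cod V h = w'"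
  shows "(f \<otimes> (g \<otimes> h)) \<cdot> \<alpha>\<^sup>- u' v' w' = \<alpha>\<^sup>- (Dom V f) (Dom V g) (Dom V h) \<cdot> ((f \<otimes> g) \<otimes> h)"
proof -
  have obj: "u' \<in> Obj V" "v' \<in> Obj V" "w' \<in> Obj V"
    using assms by auto
  show ?thesis
  proof (rule mono_iso[of "\<alpha> u' v' w'"])
    show "((f \<otimes> (g \<otimes> h)) \<cdot> \<alpha>\<^sup>- u' v' w') \<cdot> \<alpha> u' v' w'
      = (\<alpha>\<^sup>- (Dom V f) (Dom V g) (Dom V h) \<cdot> ((f \<otimes> g) \<otimes> h)) \<cdot> \<alpha> u' v' w'"
      using assms obj by (simp add: Assoc_natural_Arr)
  qed (use assms obj in \<open>auto intro: Assoc_iso\<close>)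
qed

lemma LUnit_natural_Arr:
  "\<lbrakk>f \<in> Arr V; Cod V f = u\<rbrakk> \<Longrightarrow> (\<one> \<I> \<otimes> f) \<cdot> \<l> u = \<l> (Dom V f) \<cdot> f"
  using LUnit_natural[of f] by (auto simp: Hom_def)

lemma RUnit_natural_Arr:
  "\<lbrakk>f \<in> Arr V; Cod V f = u\<rbrakk> \<Longrightarrow> (f \<otimes> \<one> \<I>) \<cdot> \<r> u = \<r> (Dom V f) \<cdot> f"
  using RUnit_natural[of f] by (auto simp: Hom_def)

lemma pentagon_Arr:
  "\<lbrakk>t \<in> Obj V; u \<in> Obj V; v \<in> Obj V; w \<in> Obj V\<rbrakk>
    \<Longrightarrow> (\<alpha> t u v \<otimes> \<one> w) \<cdot> (\<alpha> t (u \<odot> v) w \<cdot> (\<one> t \<otimes> \<alpha> u v w))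
        = \<alpha> (t \<odot> u) v w \<cdot> \<alpha> t u (v \<odot> w)"
  using pentagon[of t u v w] by simp

section \<open>Faithfulness of tensoring with the unit, and Kelly's triangles\<close>

lemma TArr_unit_faithful:
  assumes "f \<in> Hom V a b" "g \<in> Hom V a b" "f \<otimes> \<one> \<I> = g \<otimes> \<one> \<I>"
  shows "f = g"
proof (rule epi_iso[of "\<r> a"])
  show "\<r> a \<cdot> f = \<r> a \<cdot> g"
    using RUnit_natural[OF assms(1)] RUnit_natural[OF assms(2)] assms(3) by simp
qed (use assms in \<open>auto simp: Hom_def intro: RUnit_iso\<close>)

lemma unit_TArr_faithful:
  assumes "f \<in> Hom V a b" "g \<in> Hom V a b" "\<one> \<I> \<otimes> f = \<one> \<I> \<otimes> g"
  shows "f = g"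
proof (rule epi_iso[of "\<l> a"])
  show "\<l> a \<cdot> f = \<l> a \<cdot> g"
    using LUnit_natural[OF assms(1)] LUnit_natural[OF assms(2)] assms(3) by simp
qed (use assms in \<open>auto simp: Hom_def intro: LUnit_iso\<close>)

text \<open>Tensoring with \<I> is faithful, so the equation may be tested after - \<otimes>
  \<open>\<one> \<I>\<close>. Composed with \<alpha> it then follows from the pentagon for u, v,
  \<I>, \<I>, with the triangle axiom used at v and at u \<odot> v.\<close>

lemma Assoc_RUnit:
  assumes [simp]: "u \<in> Obj V" "v \<in> Obj V"
  shows "\<alpha> u v \<I> \<cdot> (\<one> u \<otimes> \<r> v) = \<r> (u \<odot> v)"
proof (rule TArr_unit_faithful)
  show "(\<alpha> u v \<I> \<cdot> (\<one> u \<otimes> \<r> v)) \<otimes> \<one> \<I> = \<r> (u \<odot> v) \<otimes> \<one> \<I>"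
  proof (rule mono_iso[of "\<alpha> u v \<I>"])
    have "((\<alpha> u v \<I> \<cdot> (\<one> u \<otimes> \<r> v)) \<otimes> \<one> \<I>) \<cdot> \<alpha> u v \<I>
        = (\<alpha> u v \<I> \<otimes> \<one> \<I>) \<cdot> (((\<one> u \<otimes> \<r> v) \<otimes> \<one> \<I>) \<cdot> \<alpha> u v \<I>)"
      by (simp add: distr)
    also have "\<dots> = (\<alpha> u v \<I> \<otimes> \<one> \<I>) \<cdot> (\<alpha> u (v \<odot> \<I>) \<I> \<cdot> (\<one> u \<otimes> (\<r> v \<otimes> \<one> \<I>)))"
      by (simp add: Assoc_natural_Arr)
    also have "\<dots> = ((\<alpha> u v \<I> \<otimes> \<one> \<I>) \<cdot> (\<alpha> u (v \<odot> \<I>) \<I> \<cdot> (\<one> u \<otimes> \<alpha> v \<I> \<I>)))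
        \<cdot> (\<one> u \<otimes> (\<one> v \<otimes> \<l> \<I>))"
      by (simp add: triangle[symmetric] distr)
    also have "\<dots> = \<alpha> (u \<odot> v) \<I> \<I> \<cdot> (\<alpha> u v (\<I> \<odot> \<I>) \<cdot> (\<one> u \<otimes> (\<one> v \<otimes> \<l> \<I>)))"
      by (subst pentagon_Arr) simp_all
    also have "\<dots> = \<alpha> (u \<odot> v) \<I> \<I> \<cdot> (((\<one> u \<otimes> \<one> v) \<otimes> \<l> \<I>) \<cdot> \<alpha> u v \<I>)"
      by (subst Assoc_natural_Arr) simp_all
    also have "\<dots> = (\<alpha> (u \<odot> v) \<I> \<I> \<cdot> (\<one> (u \<odot> v) \<otimes> \<l> \<I>)) \<cdot> \<alpha> u v \<I>"
      by simp
    also have "\<dots> = (\<r> (u \<odot> v) \<otimes> \<one> \<I>) \<cdot> \<alpha> u v \<I>"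
      by (subst triangle) simp_all
    finally show "((\<alpha> u v \<I> \<cdot> (\<one> u \<otimes> \<r> v)) \<otimes> \<one> \<I>) \<cdot> \<alpha> u v \<I>
        = (\<r> (u \<odot> v) \<otimes> \<one> \<I>) \<cdot> \<alpha> u v \<I>" .
  qed (simp_all add: Assoc_iso)
qed (simp_all add: Hom_def)

text \<open>The mirror image: test after \<open>\<one> \<I>\<close> \<otimes> -, and precompose with
  two sides of the pentagon for \<I>, \<I>, u, v. These are invertible, so they can be cancelled
  afterwards.\<close>

lemma Assoc_LUnit:
  assumes [simp]: "u \<in> Obj V" "v \<in> Obj V"
  shows "\<alpha> \<I> u v \<cdot> \<l> (u \<odot> v) = \<l> u \<otimes> \<one> v"
proof -
  have iso: "iso_arr V (\<alpha> \<I> (\<I> \<odot> u) v)" "iso_arr V (\<alpha> \<I> \<I> u \<otimes> \<one> v)"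
    by (simp_all add: Assoc_iso iso_TArr_Ident)
  show ?thesis
  proof (rule unit_TArr_faithful)
    show "\<one> \<I> \<otimes> (\<alpha> \<I> u v \<cdot> \<l> (u \<odot> v)) = \<one> \<I> \<otimes> (\<l> u \<otimes> \<one> v)"
    proof (rule epi_iso[OF iso(1)], rule epi_iso[OF iso(2)])
      have "(\<alpha> \<I> \<I> u \<otimes> \<one> v) \<cdot> (\<alpha> \<I> (\<I> \<odot> u) v \<cdot> (\<one> \<I> \<otimes> (\<alpha> \<I> u v \<cdot> \<l> (u \<odot> v))))
          = ((\<alpha> \<I> \<I> u \<otimes> \<one> v) \<cdot> (\<alpha> \<I> (\<I> \<odot> u) v \<cdot> (\<one> \<I> \<otimes> \<alpha> \<I> u v))) \<cdot> (\<one> \<I> \<otimes> \<l> (u \<odot> v))"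
        by (simp add: distr)
      also have "\<dots> = \<alpha> (\<I> \<odot> \<I>) u v \<cdot> (\<alpha> \<I> \<I> (u \<odot> v) \<cdot> (\<one> \<I> \<otimes> \<l> (u \<odot> v)))"
        by (subst pentagon_Arr) simp_all
      also have "\<dots> = \<alpha> (\<I> \<odot> \<I>) u v \<cdot> (\<r> \<I> \<otimes> (\<one> u \<otimes> \<one> v))"
        by (subst triangle) simp_all
      also have "\<dots> = ((\<r> \<I> \<otimes> \<one> u) \<otimes> \<one> v) \<cdot> \<alpha> \<I> u v"
        by (subst Assoc_natural_Arr) simp_all
      also have "\<dots> = (\<alpha> \<I> \<I> u \<otimes> \<one> v) \<cdot> (((\<one> \<I> \<otimes> \<l> u) \<otimes> \<one> v) \<cdot> \<alpha> \<I> u v)"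
        by (simp add: triangle[symmetric] distr)
      also have "\<dots> = (\<alpha> \<I> \<I> u \<otimes> \<one> v) \<cdot> (\<alpha> \<I> (\<I> \<odot> u) v \<cdot> (\<one> \<I> \<otimes> (\<l> u \<otimes> \<one> v)))"
        by (subst Assoc_natural_Arr) simp_all
      finally show "(\<alpha> \<I> \<I> u \<otimes> \<one> v) \<cdot> (\<alpha> \<I> (\<I> \<odot> u) v \<cdot> (\<one> \<I> \<otimes> (\<alpha> \<I> u v \<cdot> \<l> (u \<odot> v))))
          = (\<alpha> \<I> \<I> u \<otimes> \<one> v) \<cdot> (\<alpha> \<I> (\<I> \<odot> u) v \<cdot> (\<one> \<I> \<otimes> (\<l> u \<otimes> \<one> v)))" .
    qed simp_all
  qed (simp_all add: Hom_def)
qed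

text \<open>This and the next three lemmas are the one pentagon with different sides inverted. The
  first form is what \<open>tri_assoc\<close> meets, the third serves \<open>act_assoc\<close> and
  the fourth \<open>whisk_tri\<close>; the second is the passage from the first to the
  third.\<close>

lemma pentagon_inv1:
  assumes [simp]: "t \<in> Obj V" "u \<in> Obj V" "v \<in> Obj V" "w \<in> Obj V"
  shows "(\<one> t \<otimes> \<alpha> u v w) \<cdot> (\<alpha>\<^sup>- t u (v \<odot> w) \<cdot> \<alpha>\<^sup>- (t \<odot> u) v w)
    = \<alpha>\<^sup>- t (u \<odot> v) w \<cdot> (\<alpha>\<^sup>- t u v \<otimes> \<one> w)" (is "?lhs = ?rhs")
proof -
  have "?lhs = \<alpha>\<^sup>- t (u \<odot> v) w \<cdot> ((\<alpha>\<^sup>- t u v \<otimes> \<one> w) \<cdot>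
      (((\<alpha> t u v \<otimes> \<one> w) \<cdot> (\<alpha> t (u \<odot> v) w \<cdot> (\<one> t \<otimes> \<alpha> u v w))) \<cdot>
        (\<alpha>\<^sup>- t u (v \<odot> w) \<cdot> \<alpha>\<^sup>- (t \<odot> u) v w)))"
    by simp
  also have "\<dots> = ?rhs"
    by (subst pentagon_Arr) simp_all
  finally show ?thesis .
qed

lemma pentagon_inv2:
  assumes [simp]: "t \<in> Obj V" "u \<in> Obj V" "v \<in> Obj V" "w \<in> Obj V"
  shows "(\<one> t \<otimes> \<alpha>\<^sup>- u v w) \<cdot> (\<alpha>\<^sup>- t (u \<odot> v) w \<cdot> (\<alpha>\<^sup>- t u v \<otimes> \<one> w))
    = \<alpha>\<^sup>- t u (v \<odot> w) \<cdot> \<alpha>\<^sup>- (t \<odot> u) v w"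
  by (subst pentagon_inv1[symmetric]) simp_all

lemma pentagon_inv3:
  assumes [simp]: "t \<in> Obj V" "u \<in> Obj V" "v \<in> Obj V" "w \<in> Obj V"
  shows "\<alpha>\<^sup>- t u (v \<odot> w) \<cdot> (\<alpha>\<^sup>- (t \<odot> u) v w \<cdot> (\<alpha> t u v \<otimes> \<one> w))
    = (\<one> t \<otimes> \<alpha>\<^sup>- u v w) \<cdot> \<alpha>\<^sup>- t (u \<odot> v) w" (is "?lhs = ?rhs")
proof -
  have "?lhs = (\<alpha>\<^sup>- t u (v \<odot> w) \<cdot> \<alpha>\<^sup>- (t \<odot> u) v w) \<cdot> (\<alpha> t u v \<otimes> \<one> w)"
    by simp
  also have "\<dots> = ?rhs"
    by (subst pentagon_inv2[symmetric]) simp_all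
  finally show ?thesis .
qed

lemma pentagon_inv4:
  assumes [simp]: "t \<in> Obj V" "u \<in> Obj V" "v \<in> Obj V" "w \<in> Obj V"
  shows "\<alpha>\<^sup>- (t \<odot> u) v w \<cdot> ((\<alpha> t u v \<otimes> \<one> w) \<cdot> \<alpha> t (u \<odot> v) w)
    = \<alpha> t u (v \<odot> w) \<cdot> (\<one> t \<otimes> \<alpha>\<^sup>- u v w)" (is "?lhs = ?rhs")
proof -
  have "?lhs = \<alpha> t u (v \<odot> w) \<cdot>
      ((\<alpha>\<^sup>- t u (v \<odot> w) \<cdot> (\<alpha>\<^sup>- (t \<odot> u) v w \<cdot> (\<alpha> t u v \<otimes> \<one> w))) \<cdot> \<alpha> t (u \<odot> v) w)"
    by simp
  also have "\<dots> = ?rhs"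
    by (subst pentagon_inv3) simp_all
  finally show ?thesis .
qed

section \<open>Composition of parametrised arrows\<close>

text \<open>
  \<open>tri\<close> composes \<open>f : u \<odot> h \<rightarrow> v\<close> with \<open>g : v \<odot> k \<rightarrow> x\<close>, the parameters \<open>h\<close> and \<open>k\<close> being
  tensored; \<open>whisk\<close> carries a factor \<open>A\<close> along on the left. The mate of composition in the
  self-enrichment is a \<open>tri\<close> of evaluations. In the completion the second evaluation is whiskered
  first, and composition in \<open>C\<close> then acts on the result.
\<close>

definition tri :: "'o \<Rightarrow> 'o \<Rightarrow> 'o \<Rightarrow> 'm \<Rightarrow> 'm \<Rightarrow> 'm" where
  "tri u h k f g = \<alpha>\<^sup>- u h k \<cdot> ((f \<otimes> \<one> k) \<cdot> g)"

definition whisk :: "'o \<Rightarrow> 'o \<Rightarrow> 'o \<Rightarrow> 'm \<Rightarrow> 'm" where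
  "whisk A v k g = \<alpha> A v k \<cdot> (\<one> A \<otimes> g)"

section \<open>Laws of parametrised composition and whiskering\<close>

lemma tri_simps [simp]:
  assumes "u \<in> Obj V" "h \<in> Obj V" "k \<in> Obj V" "f \<in> Arr V" "g \<in> Arr V"
    "Dom V f = u \<odot> h" "Dom V g = Cod V f \<odot> k"
  shows "tri u h k f g \<in> Arr V"
    "Dom V (tri u h k f g) = u \<odot> (h \<odot> k)"
    "Cod V (tri u h k f g) = Cod V g"
  using assms by (simp_all add: tri_def)

lemma whisk_simps [simp]:
  assumes "A \<in> Obj V" "v \<in> Obj V" "k \<in> Obj V" "g \<in> Arr V" "Dom V g = v \<odot> k"
  shows "whisk A v k g \<in> Arr V"
    "Dom V (whisk A v k g) = (A \<odot> v) \<odot> k"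
    "Cod V (whisk A v k g) = A \<odot> Cod V g"
  using assms by (simp_all add: whisk_def)

text \<open>Naturality of the inverse associator in f brings the three associators next to each
  other, and the pentagon trades them for the other bracketing of the parameters.\<close>

lemma tri_assoc:
  assumes [simp]: "u \<in> Obj V" "h \<in> Obj V" "k \<in> Obj V" "l \<in> Obj V" "v \<in> Obj V"
    "f \<in> Arr V" "g \<in> Arr V" "e \<in> Arr V"
    "Dom V f = u \<odot> h" "Cod V f = v" "Dom V g = v \<odot> k" "Dom V e = Cod V g \<odot> l"
  shows "(\<one> u \<otimes> \<alpha> h k l) \<cdot> tri u h (k \<odot> l) f (tri v k l g e)
    = tri u (h \<odot> k) l (tri u h k f g) e"
proof -
  have "(\<one> u \<otimes> \<alpha> h k l) \<cdot> tri u h (k \<odot> l) f (tri v k l g e)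
    = (\<one> u \<otimes> \<alpha> h k l) \<cdot> (\<alpha>\<^sup>- u h (k \<odot> l) \<cdot> (((f \<otimes> (\<one> k \<otimes> \<one> l)) \<cdot> \<alpha>\<^sup>- v k l) \<cdot> ((g \<otimes> \<one> l) \<cdot> e)))"
    by (simp add: tri_def)
  also have "\<dots> = ((\<one> u \<otimes> \<alpha> h k l) \<cdot> (\<alpha>\<^sup>- u h (k \<odot> l) \<cdot> \<alpha>\<^sup>- (u \<odot> h) k l))
      \<cdot> (((f \<otimes> \<one> k) \<otimes> \<one> l) \<cdot> ((g \<otimes> \<one> l) \<cdot> e))"
    by (subst assoc_inv_natural) simp_all
  also have "\<dots> = tri u (h \<odot> k) l (tri u h k f g) e"
    by (subst pentagon_inv1) (simp_all add: tri_def distr)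
  finally show ?thesis .
qed

text \<open>Carrying A along commutes with composing, by naturality of \<alpha> in g and the
  pentagon. This is the source of functoriality of the tensor and of one adjunction law.\<close>

lemma whisk_tri:
  assumes [simp]: "A \<in> Obj V" "v \<in> Obj V" "k \<in> Obj V" "l \<in> Obj V"
    "g \<in> Arr V" "e \<in> Arr V" "Dom V g = v \<odot> k" "Cod V g = w" "Dom V e = w \<odot> l" "w \<in> Obj V"
  shows "whisk A v (k \<odot> l) (tri v k l g e)
    = tri (A \<odot> v) k l (whisk A v k g) (whisk A w l e)"
proof -
  have "tri (A \<odot> v) k l (whisk A v k g) (whisk A w l e)
    = \<alpha>\<^sup>- (A \<odot> v) k l \<cdot> ((\<alpha> A v k \<otimes> \<one> l) \<cdot> ((((\<one> A \<otimes> g) \<otimes> \<one> l) \<cdot> \<alpha> A w l) \<cdot> (\<one> A \<otimes> e)))"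
    by (simp add: tri_def whisk_def distr)
  also have "\<dots> = (\<alpha>\<^sup>- (A \<odot> v) k l \<cdot> ((\<alpha> A v k \<otimes> \<one> l) \<cdot> \<alpha> A (v \<odot> k) l))
      \<cdot> ((\<one> A \<otimes> (g \<otimes> \<one> l)) \<cdot> (\<one> A \<otimes> e))"
    by (subst Assoc_natural_Arr) simp_all
  also have "\<dots> = whisk A v (k \<odot> l) (tri v k l g e)"
    by (subst pentagon_inv4) (simp_all add: tri_def whisk_def distr)
  finally show ?thesis ..
qed

text \<open>Two factors may be carried together or one after the other. The proof uses the pentagon
  in its original form, after inserting \<alpha> and its inverse at the end.\<close>

lemma whisk_whisk:
  assumes [simp]: "A \<in> Obj V" "B \<in> Obj V" "v \<in> Obj V" "k \<in> Obj V"
    "e \<in> Arr V" "Dom V e = v \<odot> k" "Cod V e = w"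
  shows "(\<alpha>\<^sup>- A B v \<otimes> \<one> k) \<cdot> whisk (A \<odot> B) v k e
    = whisk A (B \<odot> v) k (whisk B v k e) \<cdot> \<alpha>\<^sup>- A B w"
proof -
  have [simp]: "w \<in> Obj V"
    using Cod_obj[of e] by simp
  have "(\<alpha>\<^sup>- A B v \<otimes> \<one> k) \<cdot> whisk (A \<odot> B) v k e
    = (\<alpha>\<^sup>- A B v \<otimes> \<one> k) \<cdot> (\<alpha> (A \<odot> B) v k \<cdot> ((((\<one> A \<otimes> \<one> B) \<otimes> e) \<cdot> \<alpha> A B w) \<cdot> \<alpha>\<^sup>- A B w))"
    by (simp add: whisk_def)
  also have "\<dots> = (\<alpha>\<^sup>- A B v \<otimes> \<one> k) \<cdot> ((\<alpha> (A \<odot> B) v k \<cdot> \<alpha> A B (v \<odot> k))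
      \<cdot> ((\<one> A \<otimes> (\<one> B \<otimes> e)) \<cdot> \<alpha>\<^sup>- A B w))"
    by (subst Assoc_natural_Arr) simp_all
  also have "\<dots> = whisk A (B \<odot> v) k (whisk B v k e) \<cdot> \<alpha>\<^sup>- A B w"
    by (subst pentagon_Arr[symmetric]) (simp_all add: whisk_def distr)
  finally show ?thesis .
qed

lemma tri_Comp:
  assumes "u \<in> Obj V" "h \<in> Obj V" "k \<in> Obj V" "f \<in> Arr V" "g \<in> Arr V" "s \<in> Arr V"
    "Dom V f = u \<odot> h" "Dom V g = Cod V f \<odot> k" "Dom V s = Cod V g"
  shows "tri u h k f (g \<cdot> s) = tri u h k f g \<cdot> s"
  using assms by (simp add: tri_def)

text \<open>An arrow s standing between f and g does not involve the parameter k, so it may be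
  counted with either. Identities, actions and evaluations are all moved by this law.\<close>

lemma tri_slide:
  assumes "u \<in> Obj V" "h \<in> Obj V" "k \<in> Obj V" "f \<in> Arr V" "g \<in> Arr V" "s \<in> Arr V"
    "Dom V f = u \<odot> h" "Dom V s = Cod V f" "Dom V g = Cod V s \<odot> k"
  shows "tri u h k (f \<cdot> s) g = tri u h k f ((s \<otimes> \<one> k) \<cdot> g)"
  using assms by (simp add: tri_def distr)

text \<open>Reparametrisation along p and q acts on the two factors separately. It turns a tensor of
  arrows followed by enriched composition into a \<open>tri\<close> of their transposes.\<close>

lemma tri_natural:
  assumes [simp]: "u \<in> Obj V" "f \<in> Arr V" "g \<in> Arr V" "p \<in> Arr V" "q \<in> Arr V"
    "Dom V f = u \<odot> h'" "Dom V g = Cod V f \<odot> k'" "Dom V p = h" "Dom V q = k" "Cod V p = h'" "Cod V q = k'"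
  shows "(\<one> u \<otimes> (p \<otimes> q)) \<cdot> tri u h' k' f g
    = tri u h k ((\<one> u \<otimes> p) \<cdot> f) ((\<one> (Cod V f) \<otimes> q) \<cdot> g)"
proof -
  have [simp]: "h \<in> Obj V" "k \<in> Obj V" "h' \<in> Obj V" "k' \<in> Obj V"
    using Dom_obj[of p] Dom_obj[of q] Cod_obj[of p] Cod_obj[of q] by simp_all
  have "(\<one> u \<otimes> (p \<otimes> q)) \<cdot> tri u h' k' f g
    = ((\<one> u \<otimes> (p \<otimes> q)) \<cdot> \<alpha>\<^sup>- u h' k') \<cdot> ((f \<otimes> \<one> k') \<cdot> g)"
    by (simp add: tri_def)
  also have "\<dots> = tri u h k ((\<one> u \<otimes> p) \<cdot> f) ((\<one> (Cod V f) \<otimes> q) \<cdot> g)"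
    by (subst assoc_inv_natural) (simp_all add: tri_def merge)
  finally show ?thesis .
qed

lemma whisk_Comp:
  assumes "A \<in> Obj V" "v \<in> Obj V" "k \<in> Obj V" "g \<in> Arr V" "s \<in> Arr V" "Dom V g = v \<odot> k" "Dom V s = Cod V g"
  shows "whisk A v k (g \<cdot> s) = whisk A v k g \<cdot> (\<one> A \<otimes> s)"
  using assms by (simp add: whisk_def distr)

lemma whisk_natural:
  assumes [simp]: "A \<in> Obj V" "v \<in> Obj V" "g \<in> Arr V" "q \<in> Arr V"
    "Dom V g = v \<odot> k'" "Dom V q = k" "Cod V q = k'"
  shows "(\<one> (A \<odot> v) \<otimes> q) \<cdot> whisk A v k' g = whisk A v k ((\<one> v \<otimes> q) \<cdot> g)"
proof -
  have [simp]: "k \<in> Obj V" "k' \<in> Obj V"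
    using Dom_obj[of q] Cod_obj[of q] by simp_all
  have "(\<one> (A \<odot> v) \<otimes> q) \<cdot> whisk A v k' g = (((\<one> A \<otimes> \<one> v) \<otimes> q) \<cdot> \<alpha> A v k') \<cdot> (\<one> A \<otimes> g)"
    by (simp add: whisk_def)
  also have "\<dots> = whisk A v k ((\<one> v \<otimes> q) \<cdot> g)"
    by (subst Assoc_natural_Arr) (simp_all add: whisk_def distr)
  finally show ?thesis .
qed

lemma whisk_slide:
  assumes [simp]: "v \<in> Obj V" "k \<in> Obj V" "s \<in> Arr V" "g \<in> Arr V"
    "Dom V s = A'" "Cod V s = A" "Dom V g = v \<odot> k"
  shows "((s \<otimes> \<one> v) \<otimes> \<one> k) \<cdot> whisk A v k g = whisk A' v k g \<cdot> (s \<otimes> \<one> (Cod V g))"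
proof -
  have [simp]: "A \<in> Obj V" "A' \<in> Obj V"
    using Dom_obj[of s] Cod_obj[of s] by simp_all
  have "((s \<otimes> \<one> v) \<otimes> \<one> k) \<cdot> whisk A v k g = (((s \<otimes> \<one> v) \<otimes> \<one> k) \<cdot> \<alpha> A v k) \<cdot> (\<one> A \<otimes> g)"
    by (simp add: whisk_def)
  also have "\<dots> = whisk A' v k g \<cdot> (s \<otimes> \<one> (Cod V g))"
    by (subst Assoc_natural_Arr) (simp_all add: whisk_def merge)
  finally show ?thesis .
qed

text \<open>The right unitor is the transpose of the identity in the self-enrichment, so this is the
  left identity law after evaluation; it rests on the triangle axiom. The next lemma is the right
  identity law and rests on Kelly's triangle instead.\<close>

lemma tri_RUnit:
  assumes [simp]: "u \<in> Obj V" "k \<in> Obj V" "g \<in> Arr V" "Dom V g = u \<odot> k"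
  shows "tri u \<I> k (\<r> u) g = (\<one> u \<otimes> \<l> k) \<cdot> g"
proof -
  have "tri u \<I> k (\<r> u) g = \<alpha>\<^sup>- u \<I> k \<cdot> ((\<alpha> u \<I> k \<cdot> (\<one> u \<otimes> \<l> k)) \<cdot> g)"
    by (subst triangle) (simp_all add: tri_def)
  then show ?thesis
    by simp
qed

lemma tri_to_RUnit:
  assumes [simp]: "u \<in> Obj V" "h \<in> Obj V" "f \<in> Arr V" "Dom V f = u \<odot> h"
  shows "tri u h \<I> f (\<r> (Cod V f)) = (\<one> u \<otimes> \<r> h) \<cdot> f"
proof -
  have "tri u h \<I> f (\<r> (Cod V f)) = \<alpha>\<^sup>- u h \<I> \<cdot> (\<r> (u \<odot> h) \<cdot> f)"
    by (simp add: tri_def RUnit_natural_Arr)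
  also have "\<dots> = (\<one> u \<otimes> \<r> h) \<cdot> f"
    by (subst Assoc_RUnit[symmetric]) simp_all
  finally show ?thesis .
qed

lemma whisk_RUnit:
  assumes "A \<in> Obj V" "v \<in> Obj V"
  shows "whisk A v \<I> (\<r> v) = \<r> (A \<odot> v)"
  using assms by (simp add: whisk_def Assoc_RUnit)

lemma lunit_inv_natural:
  assumes "f \<in> Arr V" "Cod V f = u"
  shows "f \<cdot> \<l>\<^sup>- u = \<l>\<^sup>- (Dom V f) \<cdot> (\<one> \<I> \<otimes> f)"
proof -
  have [simp]: "u \<in> Obj V"
    using assms by auto
  show ?thesis
    by (rule mono_iso[OF LUnit_iso[of u]]) (use assms in \<open>simp_all add: LUnit_natural_Arr\<close>)
qed

text \<open>Carrying the unit object along is conjugation by left unitors, by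
  \<open>Assoc_LUnit\<close> and naturality of the unitor.\<close>

lemma whisk_LUnit:
  assumes [simp]: "v \<in> Obj V" "k \<in> Obj V" "g \<in> Arr V" "Dom V g = v \<odot> k" "Cod V g = w"
  shows "(\<l>\<^sup>- v \<otimes> \<one> k) \<cdot> whisk \<I> v k g = g \<cdot> \<l>\<^sup>- w"
proof -
  have [simp]: "w \<in> Obj V"
    using Cod_obj[of g] by simp
  have "(\<l> v \<otimes> \<one> k) \<cdot> (g \<cdot> \<l>\<^sup>- w) = whisk \<I> v k g"
    by (simp add: lunit_inv_natural[of g] whisk_def Assoc_LUnit[symmetric])
  then have "(\<l>\<^sup>- v \<otimes> \<one> k) \<cdot> whisk \<I> v k g
    = (\<l>\<^sup>- v \<otimes> \<one> k) \<cdot> ((\<l> v \<otimes> \<one> k) \<cdot> (g \<cdot> \<l>\<^sup>- w))"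
    by simp
  also have "\<dots> = g \<cdot> \<l>\<^sup>- w"
    by simp
  finally show ?thesis .
qed

end


section \<open>Transposition\<close>

context closed_monoidal_category
begin

lemmas IHom_obj' [simp] = IHom_obj

lemma Mate_simps [simp]:
  assumes "f \<in> Arr V" "u \<in> Obj V" "w \<in> Obj V" "Dom V f = u \<odot> w" "Cod V f = v"
  shows "Mate V u w v f \<in> Arr V" "Dom V (Mate V u w v f) = w"
    "Cod V (Mate V u w v f) = IHom V u v"
proof -
  have "v \<in> Obj V"
    using assms by auto
  then have "Mate V u w v f \<in> Hom V w (IHom V u v)"
    using Mate_bij[of u w v] assms by (auto simp: bij_betw_def Hom_def)
  then show "Mate V u w v f \<in> Arr V" "Dom V (Mate V u w v f) = w"
    "Cod V (Mate V u w v f) = IHom V u v"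
    by (auto simp: Hom_def)
qed

text \<open>\<open>IEval\<close> is chosen by \<open>inv_into\<close>; surjectivity of
  \<open>Mate\<close> onto the endomorphisms of the internal hom makes the choice a true preimage of
  the identity.\<close>

lemma IEval_Mate:
  assumes "u \<in> Obj V" "v \<in> Obj V"
  shows "\<epsilon> u v \<in> Hom V (u \<odot> IHom V u v) v"
    "Mate V u (IHom V u v) v (\<epsilon> u v) = \<one> (IHom V u v)"
proof -
  have b: "bij_betw (Mate V u (IHom V u v) v) (Hom V (u \<odot> IHom V u v) v)
      (Hom V (IHom V u v) (IHom V u v))"
    using Mate_bij[of u "IHom V u v" v] assms by simp
  have i: "\<one> (IHom V u v) \<in> Hom V (IHom V u v) (IHom V u v)"
    using assms by (simp add: Ident_hom)
  then show "\<epsilon> u v \<in> Hom V (u \<odot> IHom V u v) v"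
    unfolding IEval_def using b by (metis bij_betw_def inv_into_into)
  show "Mate V u (IHom V u v) v (\<epsilon> u v) = \<one> (IHom V u v)"
    unfolding IEval_def using b i by (metis bij_betw_def f_inv_into_f)
qed

lemma IEval_simps [simp]:
  assumes "u \<in> Obj V" "v \<in> Obj V"
  shows "\<epsilon> u v \<in> Arr V" "Dom V (\<epsilon> u v) = u \<odot> IHom V u v" "Cod V (\<epsilon> u v) = v"
  using IEval_Mate(1)[OF assms] by (auto simp: Hom_def)

text \<open>The Yoneda argument: naturality of \<open>Mate\<close> along g, applied to the
  evaluation, whose mate is the identity.\<close>

lemma Mate_IEval:
  assumes "g \<in> Arr V" "u \<in> Obj V" "v \<in> Obj V" "Dom V g = w" "Cod V g = IHom V u v"
  shows "Mate V u w v ((\<one> u \<otimes> g) \<cdot> \<epsilon> u v) = g"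
proof -
  have "Mate V u w v ((\<one> u \<otimes> g) \<cdot> \<epsilon> u v) = g \<cdot> Mate V u (IHom V u v) v (\<epsilon> u v)"
    by (rule Mate_natural) (use assms in \<open>auto simp: Hom_def\<close>)
  then show ?thesis
    using assms by (simp add: IEval_Mate)
qed

lemma IHom_eqI:
  assumes "(\<one> u \<otimes> f) \<cdot> \<epsilon> u v = (\<one> u \<otimes> g) \<cdot> \<epsilon> u v"
    "f \<in> Arr V" "g \<in> Arr V" "Dom V f = Dom V g" "Cod V f = IHom V u v" "Cod V g = IHom V u v"
    "u \<in> Obj V" "v \<in> Obj V"
  shows "f = g"
proof -
  have "f = Mate V u (Dom V g) v ((\<one> u \<otimes> f) \<cdot> \<epsilon> u v)"
    by (rule Mate_IEval[symmetric]) (fact assms)+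
  also have "\<dots> = Mate V u (Dom V g) v ((\<one> u \<otimes> g) \<cdot> \<epsilon> u v)"
    by (simp only: assms(1))
  also have "\<dots> = g"
    by (rule Mate_IEval) (use assms in auto)
  finally show ?thesis .
qed

lemma transpose_Mate [simp]:
  assumes "f \<in> Arr V" "u \<in> Obj V" "w \<in> Obj V" "Dom V f = u \<odot> w" "Cod V f = v"
  shows "(\<one> u \<otimes> Mate V u w v f) \<cdot> \<epsilon> u v = f"
proof -
  have v: "v \<in> Obj V"
    using assms by auto
  have inj: "inj_on (Mate V u w v) (Hom V (u \<odot> w) v)"
    using Mate_bij[of u w v] assms v by (auto simp: bij_betw_def)
  show ?thesis
    by (rule inj_onD[OF inj]) (use assms v in \<open>auto simp: Mate_IEval Hom_def\<close>)
qed

section \<open>The self-enrichment\<close>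

abbreviation scomp :: "'o \<Rightarrow> 'o \<Rightarrow> 'o \<Rightarrow> 'm" where
  "scomp u v w \<equiv> VComp (self_enrichment V) u v w"

lemma self_sel [simp]:
  "VObj (self_enrichment V) = Obj V"
  "VHom (self_enrichment V) = IHom V"
  "VId (self_enrichment V) u = Mate V u \<I> u (\<r> u)"
  by (simp_all add: self_enrichment_def)

lemma scomp_Mate:
  assumes "u \<in> Obj V" "v \<in> Obj V" "w \<in> Obj V"
  shows "scomp u v w = Mate V u (IHom V u v \<odot> IHom V v w) w
    (tri u (IHom V u v) (IHom V v w) (\<epsilon> u v) (\<epsilon> v w))"
  using assms by (simp add: self_enrichment_def tri_def)

lemma scomp_simps [simp]:
  assumes "u \<in> Obj V" "v \<in> Obj V" "w \<in> Obj V"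
  shows "scomp u v w \<in> Arr V" "Dom V (scomp u v w) = IHom V u v \<odot> IHom V v w"
    "Cod V (scomp u v w) = IHom V u w"
  using assms by (simp_all add: scomp_Mate)

lemma transpose_scomp:
  assumes "u \<in> Obj V" "v \<in> Obj V" "w \<in> Obj V"
  shows "(\<one> u \<otimes> scomp u v w) \<cdot> \<epsilon> u w
    = tri u (IHom V u v) (IHom V v w) (\<epsilon> u v) (\<epsilon> v w)"
  using assms by (simp add: scomp_Mate)

text \<open>The working form of composition in the self-enrichment: only the transposes of f and g
  remain, whatever their domains are.\<close>

lemma transpose_TArr_scomp:
  assumes [simp]: "u \<in> Obj V" "v \<in> Obj V" "w \<in> Obj V"
    "f \<in> Arr V" "g \<in> Arr V" "Dom V f = h" "Dom V g = k" "Cod V f = IHom V u v" "Cod V g = IHom V v w"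
  shows "(\<one> u \<otimes> ((f \<otimes> g) \<cdot> scomp u v w)) \<cdot> \<epsilon> u w
    = tri u h k ((\<one> u \<otimes> f) \<cdot> \<epsilon> u v) ((\<one> v \<otimes> g) \<cdot> \<epsilon> v w)"
proof -
  have "(\<one> u \<otimes> ((f \<otimes> g) \<cdot> scomp u v w)) \<cdot> \<epsilon> u w
    = (\<one> u \<otimes> (f \<otimes> g)) \<cdot> tri u (IHom V u v) (IHom V v w) (\<epsilon> u v) (\<epsilon> v w)"
    by (simp add: distr transpose_scomp)
  also have "\<dots> = tri u h k ((\<one> u \<otimes> f) \<cdot> \<epsilon> u v) ((\<one> v \<otimes> g) \<cdot> \<epsilon> v w)"
    by (subst tri_natural[where h = h and k = k]) simp_all
  finally show ?thesis .
qed

lemma V_category_self_enrichment: "V_category V (self_enrichment V)"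
proof unfold_locales
  fix a b c d
  assume "a \<in> VObj (self_enrichment V)" "b \<in> VObj (self_enrichment V)"
    "c \<in> VObj (self_enrichment V)" "d \<in> VObj (self_enrichment V)"
  then have [simp]: "a \<in> Obj V" "b \<in> Obj V" "c \<in> Obj V" "d \<in> Obj V"
    by simp_all
  let ?h = "VHom (self_enrichment V)"
  let ?L = "(scomp a b c \<otimes> \<one> (?h c d)) \<cdot> scomp a c d"
  let ?R = "(\<one> (?h a b) \<otimes> scomp b c d) \<cdot> scomp a b d"
  have "(\<one> a \<otimes> ?L) \<cdot> \<epsilon> a d
    = tri a (?h a b \<odot> ?h b c) (?h c d) (tri a (?h a b) (?h b c) (\<epsilon> a b) (\<epsilon> b c)) (\<epsilon> c d)"
    by (subst transpose_TArr_scomp) (simp_all add: transpose_scomp)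
  also have "\<dots> = (\<one> a \<otimes> \<alpha> (?h a b) (?h b c) (?h c d))
      \<cdot> tri a (?h a b) (?h b c \<odot> ?h c d) (\<epsilon> a b) (tri b (?h b c) (?h c d) (\<epsilon> b c) (\<epsilon> c d))"
    by (subst tri_assoc) simp_all
  also have "\<dots> = (\<one> a \<otimes> \<alpha> (?h a b) (?h b c) (?h c d)) \<cdot> ((\<one> a \<otimes> ?R) \<cdot> \<epsilon> a d)"
    by (subst transpose_TArr_scomp) (simp_all add: transpose_scomp)
  also have "\<dots> = (\<one> a \<otimes> (\<alpha> (?h a b) (?h b c) (?h c d) \<cdot> ?R)) \<cdot> \<epsilon> a d"
    by (simp add: distr)
  finally have "(\<one> a \<otimes> ?L) \<cdot> \<epsilon> a d
    = (\<one> a \<otimes> (\<alpha> (?h a b) (?h b c) (?h c d) \<cdot> ?R)) \<cdot> \<epsilon> a d" .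
  then have "?L = \<alpha> (?h a b) (?h b c) (?h c d) \<cdot> ?R"
    by (rule IHom_eqI) simp_all
  then show "(scomp a b c \<otimes> \<one> (?h c d)) \<cdot> scomp a c d
    = \<alpha> (?h a b) (?h b c) (?h c d) \<cdot> (\<one> (?h a b) \<otimes> scomp b c d) \<cdot> scomp a b d"
    by simp
next
  fix a b
  assume "a \<in> VObj (self_enrichment V)" "b \<in> VObj (self_enrichment V)"
  then have [simp]: "a \<in> Obj V" "b \<in> Obj V"
    by simp_all
  let ?h = "VHom (self_enrichment V)"
  show "(VId (self_enrichment V) a \<otimes> \<one> (?h a b)) \<cdot> scomp a a b = \<l> (?h a b)"
    by (rule IHom_eqI[of a _ b], subst transpose_TArr_scomp[where h = \<I> and k = "?h a b"])
      (simp_all add: tri_RUnit)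
  have "(\<one> a \<otimes> ((\<one> (?h a b) \<otimes> VId (self_enrichment V) b) \<cdot> scomp a b b)) \<cdot> \<epsilon> a b
    = tri a (?h a b) \<I> (\<epsilon> a b) (\<r> b)"
    by (subst transpose_TArr_scomp) simp_all
  also have "\<dots> = (\<one> a \<otimes> \<r> (?h a b)) \<cdot> \<epsilon> a b"
    using tri_to_RUnit[of a "IHom V a b" "\<epsilon> a b"] by simp
  finally show "(\<one> (?h a b) \<otimes> VId (self_enrichment V) b) \<cdot> scomp a b b = \<r> (?h a b)"
    by (rule IHom_eqI) simp_all
qed (simp_all add: Hom_def)

end


section \<open>Enriched categories\<close>

context V_category
begin

lemma VHom_obj' [simp]: "\<lbrakk>a \<in> VObj C; b \<in> VObj C\<rbrakk> \<Longrightarrow> VHom C a b \<in> Obj V"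
  by (rule VHom_obj)

lemma VId_simps [simp]:
  assumes "a \<in> VObj C"
  shows "VId C a \<in> Arr V" "Dom V (VId C a) = \<I>" "Cod V (VId C a) = VHom C a a"
  using VId_hom[OF assms] by (auto simp: Hom_def)

lemma VComp_simps [simp]:
  assumes "a \<in> VObj C" "b \<in> VObj C" "c \<in> VObj C"
  shows "VComp C a b c \<in> Arr V" "Dom V (VComp C a b c) = VHom C a b \<odot> VHom C b c"
    "Cod V (VComp C a b c) = VHom C a c"
  using VComp_hom[OF assms] by (auto simp: Hom_def)

lemma VComp_assoc_inv:
  assumes "a \<in> VObj C" "b \<in> VObj C" "c \<in> VObj C" "d \<in> VObj C"
  shows "\<alpha>\<^sup>- (VHom C a b) (VHom C b c) (VHom C c d) \<cdot>
      ((VComp C a b c \<otimes> \<one> (VHom C c d)) \<cdot> VComp C a c d)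
    = (\<one> (VHom C a b) \<otimes> VComp C b c d) \<cdot> VComp C a b d"
  using assms by (simp add: VComp_assoc)

text \<open>This is the last stage of composition in the completion, isolated because it obeys the
  laws of a left action of \<open>C\<close> on the objects C(b,c) w.\<close>

definition act :: "'a \<Rightarrow> 'a \<Rightarrow> 'a \<Rightarrow> 'o \<Rightarrow> 'm" where
  "act a b c w = \<alpha>\<^sup>- (VHom C a b) (VHom C b c) w \<cdot> (VComp C a b c \<otimes> \<one> w)"

lemma act_simps [simp]:
  assumes "a \<in> VObj C" "b \<in> VObj C" "c \<in> VObj C" "w \<in> Obj V"
  shows "act a b c w \<in> Arr V"
    "Dom V (act a b c w) = VHom C a b \<odot> (VHom C b c \<odot> w)"
    "Cod V (act a b c w) = VHom C a c \<odot> w"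
  using assms by (simp_all add: act_def)

text \<open>Associativity of \<open>C\<close> with w attached: naturality of the inverse associator
  collects both compositions in front of w, and the pentagon restores the bracketing.\<close>

lemma act_assoc:
  assumes [simp]: "a \<in> VObj C" "b \<in> VObj C" "c \<in> VObj C" "d \<in> VObj C" "w \<in> Obj V"
  shows "act a b c (VHom C c d \<odot> w) \<cdot> act a c d w
    = (\<one> (VHom C a b) \<otimes> act b c d w) \<cdot> act a b d w" (is "?lhs = ?rhs")
proof -
  let ?A = "VHom C a b" and ?B = "VHom C b c" and ?D = "VHom C c d"
  have "?lhs = \<alpha>\<^sup>- ?A ?B (?D \<odot> w) \<cdot> (((VComp C a b c \<otimes> (\<one> ?D \<otimes> \<one> w)) \<cdot> \<alpha>\<^sup>- (VHom C a c) ?D w)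
      \<cdot> (VComp C a c d \<otimes> \<one> w))"
    by (simp add: act_def)
  also have "\<dots> = \<alpha>\<^sup>- ?A ?B (?D \<odot> w) \<cdot> (\<alpha>\<^sup>- (?A \<odot> ?B) ?D w
      \<cdot> (((VComp C a b c \<otimes> \<one> ?D) \<cdot> VComp C a c d) \<otimes> \<one> w))"
    by (subst assoc_inv_natural) (simp_all add: TArr_Ident_Comp)
  also have "\<dots> = (\<alpha>\<^sup>- ?A ?B (?D \<odot> w) \<cdot> (\<alpha>\<^sup>- (?A \<odot> ?B) ?D w \<cdot> (\<alpha> ?A ?B ?D \<otimes> \<one> w)))
      \<cdot> (((\<one> ?A \<otimes> VComp C b c d) \<otimes> \<one> w) \<cdot> (VComp C a b d \<otimes> \<one> w))"
    by (simp add: VComp_assoc TArr_Ident_Comp)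
  also have "\<dots> = (\<one> ?A \<otimes> \<alpha>\<^sup>- ?B ?D w)
      \<cdot> ((\<alpha>\<^sup>- ?A (?B \<odot> ?D) w \<cdot> ((\<one> ?A \<otimes> VComp C b c d) \<otimes> \<one> w)) \<cdot> (VComp C a b d \<otimes> \<one> w))"
    by (subst pentagon_inv3) simp_all
  also have "\<alpha>\<^sup>- ?A (?B \<odot> ?D) w \<cdot> ((\<one> ?A \<otimes> VComp C b c d) \<otimes> \<one> w)
      = (\<one> ?A \<otimes> (VComp C b c d \<otimes> \<one> w)) \<cdot> \<alpha>\<^sup>- ?A (VHom C b d) w"
    by (subst assoc_inv_natural) simp_all
  finally show ?thesis
    by (simp add: act_def Ident_TArr_Comp)
qed

text \<open>The action touches only the hom objects and e touches only w, so the two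
  commute.\<close>

lemma act_whisk:
  assumes [simp]: "a \<in> VObj C" "b \<in> VObj C" "c \<in> VObj C" "w \<in> Obj V" "l \<in> Obj V"
    "e \<in> Arr V" "Dom V e = w \<odot> l" "Cod V e = y"
  shows "(act a b c w \<otimes> \<one> l) \<cdot> whisk (VHom C a c) w l e
    = whisk (VHom C a b) (VHom C b c \<odot> w) l (whisk (VHom C b c) w l e) \<cdot> act a b c y"
proof -
  let ?A = "VHom C a b" and ?B = "VHom C b c"
  have [simp]: "y \<in> Obj V"
    using Cod_obj[of e] by simp
  have "(act a b c w \<otimes> \<one> l) \<cdot> whisk (VHom C a c) w l e
    = (\<alpha>\<^sup>- ?A ?B w \<otimes> \<one> l) \<cdot> (((VComp C a b c \<otimes> \<one> w) \<otimes> \<one> l) \<cdot> whisk (VHom C a c) w l e)"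
    by (simp add: act_def TArr_Ident_Comp)
  also have "\<dots> = ((\<alpha>\<^sup>- ?A ?B w \<otimes> \<one> l) \<cdot> whisk (?A \<odot> ?B) w l e) \<cdot> (VComp C a b c \<otimes> \<one> y)"
    by (subst whisk_slide[where A' = "?A \<odot> ?B"]) simp_all
  also have "\<dots> = whisk ?A (?B \<odot> w) l (whisk ?B w l e) \<cdot> act a b c y"
    by (subst whisk_whisk[where w = y]) (simp_all add: act_def)
  finally show ?thesis .
qed

text \<open>Associativity in the completion, for arbitrary parametrised arrows in place of
  evaluations. Once all actions are pushed to the end, the rest is associative by
  \<open>tri_assoc\<close>; the two actions are exchanged by \<open>act_assoc\<close>, and
  \<open>act_whisk\<close> brings one of them back between g and e.\<close>

lemma tri_whisk_act_assoc:
  assumes [simp]: "a \<in> VObj C" "b \<in> VObj C" "c \<in> VObj C" "d \<in> VObj C"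
    "u \<in> Obj V" "v \<in> Obj V" "w \<in> Obj V" "x \<in> Obj V" "h \<in> Obj V" "k \<in> Obj V" "l \<in> Obj V"
    "f \<in> Arr V" "g \<in> Arr V" "e \<in> Arr V"
    "Dom V f = u \<odot> h" "Cod V f = VHom C a b \<odot> v"
    "Dom V g = v \<odot> k" "Cod V g = VHom C b c \<odot> w"
    "Dom V e = w \<odot> l" "Cod V e = VHom C c d \<odot> x"
  shows "(\<one> u \<otimes> \<alpha> h k l) \<cdot> tri u h (k \<odot> l) f
      (whisk (VHom C a b) v (k \<odot> l) (tri v k l g (whisk (VHom C b c) w l e \<cdot> act b c d x)) \<cdot> act a b d x)
    = tri u (h \<odot> k) l (tri u h k f (whisk (VHom C a b) v k g \<cdot> act a b c w))
        (whisk (VHom C a c) w l e \<cdot> act a c d x)" (is "?lhs = ?rhs")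
proof -
  let ?A = "VHom C a b" and ?B = "VHom C b c"
  let ?W = "whisk ?B w l e" and ?E = "VHom C c d \<odot> x"
  let ?X = "tri u h k f (whisk ?A v k g)" and ?Y = "whisk ?A (?B \<odot> w) l ?W"
  have "whisk ?A v (k \<odot> l) (tri v k l g (?W \<cdot> act b c d x))
    = whisk ?A v (k \<odot> l) (tri v k l g ?W) \<cdot> (\<one> ?A \<otimes> act b c d x)"
    by (simp add: tri_Comp whisk_Comp)
  also have "\<dots> = tri (?A \<odot> v) k l (whisk ?A v k g) ?Y \<cdot> (\<one> ?A \<otimes> act b c d x)"
    by (subst whisk_tri[where w = "?B \<odot> w"]) simp_all
  finally have "?lhs = (\<one> u \<otimes> \<alpha> h k l) \<cdot> (tri u h (k \<odot> l) f (tri (?A \<odot> v) k l (whisk ?A v k g) ?Y)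
      \<cdot> ((\<one> ?A \<otimes> act b c d x) \<cdot> act a b d x))"
    by (simp add: tri_Comp)
  also have "\<dots> = ((\<one> u \<otimes> \<alpha> h k l) \<cdot> tri u h (k \<odot> l) f (tri (?A \<odot> v) k l (whisk ?A v k g) ?Y))
      \<cdot> ((\<one> ?A \<otimes> act b c d x) \<cdot> act a b d x)"
    by simp
  also have "\<dots> = tri u (h \<odot> k) l ?X ?Y \<cdot> (act a b c ?E \<cdot> act a c d x)"
    by (subst tri_assoc) (simp_all add: act_assoc)
  also have "\<dots> = tri u (h \<odot> k) l ?X ((?Y \<cdot> act a b c ?E) \<cdot> act a c d x)"
    by (simp add: tri_Comp)
  also have "\<dots> = tri u (h \<odot> k) l ?X ((act a b c w \<otimes> \<one> l) \<cdot> (whisk (VHom C a c) w l e \<cdot> act a c d x))"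
    by (subst act_whisk[symmetric]) simp_all
  also have "\<dots> = tri u (h \<odot> k) l (?X \<cdot> act a b c w) (whisk (VHom C a c) w l e \<cdot> act a c d x)"
    by (subst tri_slide) simp_all
  also have "\<dots> = ?rhs"
    by (simp add: tri_Comp)
  finally show ?thesis .
qed

lemma act_VId:
  assumes [simp]: "a \<in> VObj C" "b \<in> VObj C" "w \<in> Obj V"
  shows "(VId C a \<otimes> \<one> (VHom C a b \<odot> w)) \<cdot> act a a b w = \<l> (VHom C a b \<odot> w)"
proof -
  let ?A = "VHom C a b"
  have "(VId C a \<otimes> \<one> (?A \<odot> w)) \<cdot> act a a b w
    = ((VId C a \<otimes> (\<one> ?A \<otimes> \<one> w)) \<cdot> \<alpha>\<^sup>- (VHom C a a) ?A w) \<cdot> (VComp C a a b \<otimes> \<one> w)"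
    by (simp add: act_def)
  also have "\<dots> = \<alpha>\<^sup>- \<I> ?A w \<cdot> (((VId C a \<otimes> \<one> ?A) \<cdot> VComp C a a b) \<otimes> \<one> w)"
    by (subst assoc_inv_natural) (simp_all add: TArr_Ident_Comp)
  also have "\<dots> = \<alpha>\<^sup>- \<I> ?A w \<cdot> (\<alpha> \<I> ?A w \<cdot> \<l> (?A \<odot> w))"
    by (simp add: VId_VComp Assoc_LUnit)
  finally show ?thesis
    by simp
qed

text \<open>Right identity of the action. Here the unit sits in the middle, so the triangle axiom
  suffices, whereas \<open>act_VId\<close> has it on the left and needs Kelly's triangle.\<close>

lemma act_to_VId:
  assumes [simp]: "a \<in> VObj C" "b \<in> VObj C" "w \<in> Obj V"
  shows "(\<one> (VHom C a b) \<otimes> (\<l>\<^sup>- w \<cdot> (VId C b \<otimes> \<one> w))) \<cdot> act a b b w = \<one> (VHom C a b \<odot> w)"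
proof -
  let ?A = "VHom C a b"
  have "(\<one> ?A \<otimes> (\<l>\<^sup>- w \<cdot> (VId C b \<otimes> \<one> w))) \<cdot> act a b b w
    = (\<one> ?A \<otimes> \<l>\<^sup>- w) \<cdot> (((\<one> ?A \<otimes> (VId C b \<otimes> \<one> w)) \<cdot> \<alpha>\<^sup>- ?A (VHom C b b) w) \<cdot> (VComp C a b b \<otimes> \<one> w))"
    by (simp add: act_def Ident_TArr_Comp)
  also have "\<dots> = (\<one> ?A \<otimes> \<l>\<^sup>- w) \<cdot> (\<alpha>\<^sup>- ?A \<I> w \<cdot> (((\<one> ?A \<otimes> VId C b) \<cdot> VComp C a b b) \<otimes> \<one> w))"
    by (subst assoc_inv_natural) (simp_all add: TArr_Ident_Comp)
  also have "\<dots> = (\<one> ?A \<otimes> \<l>\<^sup>- w) \<cdot> (\<alpha>\<^sup>- ?A \<I> w \<cdot> (\<alpha> ?A \<I> w \<cdot> (\<one> ?A \<otimes> \<l> w)))"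
    by (simp add: VComp_VId triangle)
  finally show ?thesis
    by simp
qed

text \<open>Inserting the identity of a before g has no effect: the identity slides past the
  whiskered g, meets the action and becomes a left unitor, which cancels the one inserted. Besides
  the identity law of the completion, this is what makes the tensor functor computable.\<close>

lemma whisk_act_VId:
  assumes [simp]: "a \<in> VObj C" "b \<in> VObj C" "w \<in> Obj V" "v \<in> Obj V" "k \<in> Obj V"
    "g \<in> Arr V" "Dom V g = v \<odot> k" "Cod V g = VHom C a b \<odot> w"
  shows "((\<l>\<^sup>- v \<cdot> (VId C a \<otimes> \<one> v)) \<otimes> \<one> k) \<cdot> (whisk (VHom C a a) v k g \<cdot> act a a b w) = g"
proof -
  have "((\<l>\<^sup>- v \<cdot> (VId C a \<otimes> \<one> v)) \<otimes> \<one> k) \<cdot> (whisk (VHom C a a) v k g \<cdot> act a a b w)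
    = (\<l>\<^sup>- v \<otimes> \<one> k) \<cdot> ((((VId C a \<otimes> \<one> v) \<otimes> \<one> k) \<cdot> whisk (VHom C a a) v k g) \<cdot> act a a b w)"
    by (simp add: TArr_Ident_Comp)
  also have "\<dots> = ((\<l>\<^sup>- v \<otimes> \<one> k) \<cdot> whisk \<I> v k g)
      \<cdot> ((VId C a \<otimes> \<one> (VHom C a b \<odot> w)) \<cdot> act a a b w)"
    by (subst whisk_slide[where A' = \<I>]) simp_all
  also have "\<dots> = g \<cdot> (\<l>\<^sup>- (VHom C a b \<odot> w) \<cdot> \<l> (VHom C a b \<odot> w))"
    by (subst whisk_LUnit[where w = "VHom C a b \<odot> w"]) (simp_all add: act_VId)
  finally show ?thesis
    by simp
qed

end


text \<open>The locale is applied to \<open>C\<close> and again to its completion, whose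
  representable functors are thereby instances of the result for a general enriched
  category.\<close>

locale closed_V_category = closed_monoidal_category V + V_category V C
  for V :: "('o, 'm, 'z) closed_moncat_scheme" (structure)
    and C :: "('a, 'o, 'm) vcat"
begin

section \<open>Representable enriched functors\<close>

lemma representable_sel [simp]:
  "VFObj (representable V C a) b = VHom C a b"
  "VFArr (representable V C a) b c = Mate V (VHom C a b) (VHom C b c) (VHom C a c) (VComp C a b c)"
  by (simp_all add: representable_def)

text \<open>After evaluation, preservation of composition is associativity in the enriched category
  with the associator moved to the other side, and preservation of identities is its right identity
  law.\<close>

lemma V_functor_representable:
  assumes [simp]: "a \<in> VObj C"
  shows "V_functor V C (self_enrichment V) (representable V C a)"
proof (intro V_functor.intro V_functor_axioms.intro V_category_self_enrichment)
  show "V_category V C" ..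
next
  fix b
  assume [simp]: "b \<in> VObj C"
  have "VId C b \<cdot> VFArr (representable V C a) b b = Mate V (VHom C a b) \<I> (VHom C a b) (\<r> (VHom C a b))"
    by (rule IHom_eqI[of "VHom C a b" _ "VHom C a b"]) (simp_all add: Ident_TArr_Comp VComp_VId)
  then show "VId C b \<cdot> VFArr (representable V C a) b b
      = VId (self_enrichment V) (VFObj (representable V C a) b)"
    by simp
next
  fix b c d
  assume [simp]: "b \<in> VObj C" "c \<in> VObj C" "d \<in> VObj C"
  let ?F = "VFArr (representable V C a)" and ?H = "VHom C a"
  have "(\<one> (?H b) \<otimes> ((?F b c \<otimes> ?F c d) \<cdot> scomp (?H b) (?H c) (?H d))) \<cdot> \<epsilon> (?H b) (?H d)
    = tri (?H b) (VHom C b c) (VHom C c d) (VComp C a b c) (VComp C a c d)"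
    by (subst transpose_TArr_scomp[where h = "VHom C b c" and k = "VHom C c d"]) simp_all
  also have "\<dots> = (\<one> (?H b) \<otimes> (VComp C b c d \<cdot> ?F b d)) \<cdot> \<epsilon> (?H b) (?H d)"
    by (simp add: tri_def VComp_assoc_inv Ident_TArr_Comp)
  finally have "(?F b c \<otimes> ?F c d) \<cdot> scomp (?H b) (?H c) (?H d) = VComp C b c d \<cdot> ?F b d"
    by (rule IHom_eqI[of "?H b" _ "?H d"]) simp_all
  then show "VComp C b c d \<cdot> ?F b d = (?F b c \<otimes> ?F c d)
      \<cdot> scomp (VFObj (representable V C a) b) (VFObj (representable V C a) c) (VFObj (representable V C a) d)"
    by simp
qed (simp_all add: Hom_def)

end


section \<open>The completion\<close>

context closed_V_category
begin

abbreviation ccomp where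
  "ccomp x y z \<equiv> VComp (completion V C) x y z"

lemma completion_sel [simp]:
  "a \<lhd> u \<in> VObj (completion V C) \<longleftrightarrow> a \<in> VObj C \<and> u \<in> Obj V"
  "VHom (completion V C) (a \<lhd> u) (b \<lhd> v) = IHom V u (VHom C a b \<odot> v)"
  by (simp_all add: completion_def)

lemma VObj_completionE:
  assumes "x \<in> VObj (completion V C)"
  obtains a u where "x = a \<lhd> u" "a \<in> VObj C" "u \<in> Obj V"
  using assms by (auto simp: completion_def)

lemma completion_VId:
  assumes "a \<in> VObj C" "u \<in> Obj V"
  shows "VId (completion V C) (a \<lhd> u)
    = Mate V u \<I> (VHom C a a \<odot> u) (\<r> u \<cdot> (\<l>\<^sup>- u \<cdot> (VId C a \<otimes> \<one> u)))"
  using assms by (simp add: completion_def)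

lemma ccomp_Mate:
  assumes "a \<in> VObj C" "b \<in> VObj C" "c \<in> VObj C" "u \<in> Obj V" "v \<in> Obj V" "w \<in> Obj V"
  shows "ccomp (a \<lhd> u) (b \<lhd> v) (c \<lhd> w)
    = (let h = IHom V u (VHom C a b \<odot> v); k = IHom V v (VHom C b c \<odot> w)
       in Mate V u (h \<odot> k) (VHom C a c \<odot> w) (tri u h k (\<epsilon> u (VHom C a b \<odot> v))
         (whisk (VHom C a b) v k (\<epsilon> v (VHom C b c \<odot> w)) \<cdot> act a b c w)))"
  using assms by (simp add: completion_def tri_def whisk_def act_def Let_def)

lemma completion_VId_simps [simp]:
  assumes "a \<in> VObj C" "u \<in> Obj V"
  shows "VId (completion V C) (a \<lhd> u) \<in> Arr V"
    "Dom V (VId (completion V C) (a \<lhd> u)) = \<I>"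
    "Cod V (VId (completion V C) (a \<lhd> u)) = IHom V u (VHom C a a \<odot> u)"
  using assms by (simp_all add: completion_VId)

lemma ccomp_simps [simp]:
  assumes "a \<in> VObj C" "b \<in> VObj C" "c \<in> VObj C" "u \<in> Obj V" "v \<in> Obj V" "w \<in> Obj V"
  shows "ccomp (a \<lhd> u) (b \<lhd> v) (c \<lhd> w) \<in> Arr V"
    "Dom V (ccomp (a \<lhd> u) (b \<lhd> v) (c \<lhd> w))
      = IHom V u (VHom C a b \<odot> v) \<odot> IHom V v (VHom C b c \<odot> w)"
    "Cod V (ccomp (a \<lhd> u) (b \<lhd> v) (c \<lhd> w)) = IHom V u (VHom C a c \<odot> w)"
  using assms by (simp_all add: ccomp_Mate Let_def)

lemma transpose_completion_VId:
  assumes "a \<in> VObj C" "u \<in> Obj V"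
  shows "(\<one> u \<otimes> VId (completion V C) (a \<lhd> u)) \<cdot> \<epsilon> u (VHom C a a \<odot> u)
    = \<r> u \<cdot> (\<l>\<^sup>- u \<cdot> (VId C a \<otimes> \<one> u))"
  using assms by (simp add: completion_VId)

lemma transpose_ccomp:
  assumes "a \<in> VObj C" "b \<in> VObj C" "c \<in> VObj C" "u \<in> Obj V" "v \<in> Obj V" "w \<in> Obj V"
    "h = IHom V u (VHom C a b \<odot> v)" "k = IHom V v (VHom C b c \<odot> w)"
  shows "(\<one> u \<otimes> ccomp (a \<lhd> u) (b \<lhd> v) (c \<lhd> w)) \<cdot> \<epsilon> u (VHom C a c \<odot> w)
    = tri u h k (\<epsilon> u (VHom C a b \<odot> v))
        (whisk (VHom C a b) v k (\<epsilon> v (VHom C b c \<odot> w)) \<cdot> act a b c w)"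
  using assms by (simp add: ccomp_Mate Let_def)

text \<open>The counterpart of \<open>transpose_TArr_scomp\<close> for the completion: the second
  transpose is carried past C(a,b), and the action composes the hom objects.\<close>

lemma transpose_TArr_ccomp:
  assumes [simp]: "a \<in> VObj C" "b \<in> VObj C" "c \<in> VObj C" "u \<in> Obj V" "v \<in> Obj V" "w \<in> Obj V"
    "f \<in> Arr V" "g \<in> Arr V" "Dom V f = h" "Dom V g = k"
    "Cod V f = IHom V u (VHom C a b \<odot> v)" "Cod V g = IHom V v (VHom C b c \<odot> w)"
  shows "(\<one> u \<otimes> ((f \<otimes> g) \<cdot> ccomp (a \<lhd> u) (b \<lhd> v) (c \<lhd> w))) \<cdot> \<epsilon> u (VHom C a c \<odot> w)
    = tri u h k ((\<one> u \<otimes> f) \<cdot> \<epsilon> u (VHom C a b \<odot> v))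
        (whisk (VHom C a b) v k ((\<one> v \<otimes> g) \<cdot> \<epsilon> v (VHom C b c \<odot> w)) \<cdot> act a b c w)"
proof -
  let ?A = "VHom C a b"
  let ?h = "IHom V u (?A \<odot> v)" and ?k = "IHom V v (VHom C b c \<odot> w)"
  let ?e = "\<epsilon> v (VHom C b c \<odot> w)"
  have [simp]: "h \<in> Obj V" "k \<in> Obj V"
    using Dom_obj[of f] Dom_obj[of g] by simp_all
  have "(\<one> u \<otimes> ((f \<otimes> g) \<cdot> ccomp (a \<lhd> u) (b \<lhd> v) (c \<lhd> w))) \<cdot> \<epsilon> u (VHom C a c \<odot> w)
    = (\<one> u \<otimes> (f \<otimes> g)) \<cdot> tri u ?h ?k (\<epsilon> u (?A \<odot> v)) (whisk ?A v ?k ?e \<cdot> act a b c w)"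
    by (simp add: Ident_TArr_Comp transpose_ccomp)
  also have "\<dots> = tri u h k ((\<one> u \<otimes> f) \<cdot> \<epsilon> u (?A \<odot> v))
      (((\<one> (?A \<odot> v) \<otimes> g) \<cdot> whisk ?A v ?k ?e) \<cdot> act a b c w)"
    by (subst tri_natural[where h = h and k = k]) (simp_all del: TArr_Ident')
  also have "(\<one> (?A \<odot> v) \<otimes> g) \<cdot> whisk ?A v ?k ?e = whisk ?A v k ((\<one> v \<otimes> g) \<cdot> ?e)"
    by (rule whisk_natural) simp_all
  finally show ?thesis .
qed

lemma V_category_completion: "V_category V (completion V C)"
proof (intro V_category.intro V_category_axioms.intro)
  show "monoidal_category V" ..
next
  fix x y z t
  assume "x \<in> VObj (completion V C)" "y \<in> VObj (completion V C)"
    "z \<in> VObj (completion V C)" "t \<in> VObj (completion V C)"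
  then obtain a u b v c w d s where xyzt: "x = a \<lhd> u" "y = b \<lhd> v" "z = c \<lhd> w" "t = d \<lhd> s"
    and [simp]: "a \<in> VObj C" "u \<in> Obj V" "b \<in> VObj C" "v \<in> Obj V" "c \<in> VObj C" "w \<in> Obj V"
      "d \<in> VObj C" "s \<in> Obj V"
    by (elim VObj_completionE) blast
  let ?A = "VHom C a b" and ?B = "VHom C b c" and ?E = "VHom C c d"
  let ?h = "IHom V u (?A \<odot> v)" and ?k = "IHom V v (?B \<odot> w)" and ?l = "IHom V w (?E \<odot> s)"
  let ?f = "\<epsilon> u (?A \<odot> v)" and ?g = "\<epsilon> v (?B \<odot> w)" and ?e = "\<epsilon> w (?E \<odot> s)"
  let ?L = "(ccomp x y z \<otimes> \<one> ?l) \<cdot> ccomp x z t" and ?R = "(\<one> ?h \<otimes> ccomp y z t) \<cdot> ccomp x y t"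
  have "(\<one> u \<otimes> ?L) \<cdot> \<epsilon> u (VHom C a d \<odot> s)
    = tri u (?h \<odot> ?k) ?l (tri u ?h ?k ?f (whisk ?A v ?k ?g \<cdot> act a b c w))
        (whisk (VHom C a c) w ?l ?e \<cdot> act a c d s)"
    unfolding xyzt
    by (subst transpose_TArr_ccomp[where h = "?h \<odot> ?k" and k = ?l])
      (simp_all add: transpose_ccomp)
  also have "\<dots> = (\<one> u \<otimes> \<alpha> ?h ?k ?l) \<cdot> tri u ?h (?k \<odot> ?l) ?f
      (whisk ?A v (?k \<odot> ?l) (tri v ?k ?l ?g (whisk ?B w ?l ?e \<cdot> act b c d s)) \<cdot> act a b d s)"
    by (subst tri_whisk_act_assoc) simp_all
  also have "\<dots> = (\<one> u \<otimes> \<alpha> ?h ?k ?l) \<cdot> ((\<one> u \<otimes> ?R) \<cdot> \<epsilon> u (VHom C a d \<odot> s))"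
    unfolding xyzt
    by (subst transpose_TArr_ccomp[where h = ?h and k = "?k \<odot> ?l"])
      (simp_all add: transpose_ccomp)
  also have "\<dots> = (\<one> u \<otimes> (\<alpha> ?h ?k ?l \<cdot> ?R)) \<cdot> \<epsilon> u (VHom C a d \<odot> s)"
    by (simp add: xyzt Ident_TArr_Comp)
  finally have "?L = \<alpha> ?h ?k ?l \<cdot> ?R"
    by (rule IHom_eqI) (simp_all add: xyzt)
  then show "(ccomp x y z \<otimes> \<one> (VHom (completion V C) z t)) \<cdot> ccomp x z t
      = \<alpha> (VHom (completion V C) x y) (VHom (completion V C) y z) (VHom (completion V C) z t)
        \<cdot> (\<one> (VHom (completion V C) x y) \<otimes> ccomp y z t) \<cdot> ccomp x y t"
    by (simp add: xyzt)
next
  fix x y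
  assume "x \<in> VObj (completion V C)" "y \<in> VObj (completion V C)"
  then obtain a u b v where xy: "x = a \<lhd> u" "y = b \<lhd> v"
    and [simp]: "a \<in> VObj C" "u \<in> Obj V" "b \<in> VObj C" "v \<in> Obj V"
    by (elim VObj_completionE) blast
  let ?A = "VHom C a b"
  let ?h = "IHom V u (?A \<odot> v)"
  let ?j = "\<l>\<^sup>- u \<cdot> (VId C a \<otimes> \<one> u)" and ?i = "\<l>\<^sup>- v \<cdot> (VId C b \<otimes> \<one> v)"
  have "(\<one> u \<otimes> ((VId (completion V C) x \<otimes> \<one> ?h) \<cdot> ccomp x x y)) \<cdot> \<epsilon> u (?A \<odot> v)
    = tri u \<I> ?h (\<r> u \<cdot> ?j) (whisk (VHom C a a) u ?h (\<epsilon> u (?A \<odot> v)) \<cdot> act a a b v)"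
    unfolding xy
    by (subst transpose_TArr_ccomp[where h = \<I> and k = ?h]) (simp_all add: transpose_completion_VId)
  also have "\<dots> = tri u \<I> ?h (\<r> u)
      ((?j \<otimes> \<one> ?h) \<cdot> (whisk (VHom C a a) u ?h (\<epsilon> u (?A \<odot> v)) \<cdot> act a a b v))"
    by (rule tri_slide) simp_all
  also have "\<dots> = tri u \<I> ?h (\<r> u) (\<epsilon> u (?A \<odot> v))"
    by (subst whisk_act_VId) simp_all
  also have "\<dots> = (\<one> u \<otimes> \<l> ?h) \<cdot> \<epsilon> u (?A \<odot> v)"
    by (simp add: tri_RUnit)
  finally have "(VId (completion V C) x \<otimes> \<one> ?h) \<cdot> ccomp x x y = \<l> ?h"
    by (rule IHom_eqI) (simp_all add: xy)
  then show "(VId (completion V C) x \<otimes> \<one> (VHom (completion V C) x y)) \<cdot> ccomp x x y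
      = \<l> (VHom (completion V C) x y)"
    by (simp add: xy)
  have "(\<one> u \<otimes> ((\<one> ?h \<otimes> VId (completion V C) y) \<cdot> ccomp x y y)) \<cdot> \<epsilon> u (?A \<odot> v)
    = tri u ?h \<I> (\<epsilon> u (?A \<odot> v)) (whisk ?A v \<I> (\<r> v \<cdot> ?i) \<cdot> act a b b v)"
    unfolding xy
    by (subst transpose_TArr_ccomp[where h = ?h and k = \<I>]) (simp_all add: transpose_completion_VId)
  \<comment> \<open>Kelly's right triangle, as \<open>whisk_RUnit\<close>, lets the unitor leave the
    whiskering; the inserted identity is then next to the action, which absorbs it.\<close>
  also have "whisk ?A v \<I> (\<r> v \<cdot> ?i) \<cdot> act a b b v = \<r> (?A \<odot> v) \<cdot> ((\<one> ?A \<otimes> ?i) \<cdot> act a b b v)"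
    by (subst whisk_Comp) (simp_all add: whisk_RUnit)
  also have "\<dots> = \<r> (?A \<odot> v)"
    by (subst act_to_VId) simp_all
  also have "tri u ?h \<I> (\<epsilon> u (?A \<odot> v)) (\<r> (?A \<odot> v)) = (\<one> u \<otimes> \<r> ?h) \<cdot> \<epsilon> u (?A \<odot> v)"
    using tri_to_RUnit[of u ?h "\<epsilon> u (?A \<odot> v)"] by simp
  finally have "(\<one> ?h \<otimes> VId (completion V C) y) \<cdot> ccomp x y y = \<r> ?h"
    by (rule IHom_eqI) (simp_all add: xy)
  then show "(\<one> (VHom (completion V C) x y) \<otimes> VId (completion V C) y) \<cdot> ccomp x y y
      = \<r> (VHom (completion V C) x y)"
    by (simp add: xy)
qed (auto elim!: VObj_completionE simp: Hom_def)

end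


section \<open>Currying\<close>

context closed_monoidal_category
begin

definition curry_arr :: "'o \<Rightarrow> 'o \<Rightarrow> 'o \<Rightarrow> 'm" where
  "curry_arr u w X = Mate V w (IHom V (u \<odot> w) X) (IHom V u X)
    (Mate V u (w \<odot> IHom V (u \<odot> w) X) X (\<alpha>\<^sup>- u w (IHom V (u \<odot> w) X) \<cdot> \<epsilon> (u \<odot> w) X))"

definition uncurry_arr :: "'o \<Rightarrow> 'o \<Rightarrow> 'o \<Rightarrow> 'm" where
  "uncurry_arr u w X = Mate V (u \<odot> w) (IHom V w (IHom V u X)) X
    (whisk u w (IHom V w (IHom V u X)) (\<epsilon> w (IHom V u X)) \<cdot> \<epsilon> u X)"

lemma curry_simps [simp]:
  assumes "u \<in> Obj V" "w \<in> Obj V" "X \<in> Obj V"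
  shows "curry_arr u w X \<in> Arr V" "Dom V (curry_arr u w X) = IHom V (u \<odot> w) X"
    "Cod V (curry_arr u w X) = IHom V w (IHom V u X)"
    "uncurry_arr u w X \<in> Arr V" "Dom V (uncurry_arr u w X) = IHom V w (IHom V u X)"
    "Cod V (uncurry_arr u w X) = IHom V (u \<odot> w) X"
  using assms by (simp_all add: curry_arr_def uncurry_arr_def)

lemma transpose_uncurry:
  assumes "u \<in> Obj V" "w \<in> Obj V" "X \<in> Obj V"
  shows "(\<one> (u \<odot> w) \<otimes> uncurry_arr u w X) \<cdot> \<epsilon> (u \<odot> w) X
    = whisk u w (IHom V w (IHom V u X)) (\<epsilon> w (IHom V u X)) \<cdot> \<epsilon> u X"
  using assms by (simp add: uncurry_arr_def)

text \<open>\<open>whisk\<close> of the outer evaluation followed by the inner one is the two-stage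
  evaluation of [w,[u,X]] on u w. Reparametrising it along f affects the outer stage alone.\<close>

lemma whisk_transpose:
  assumes [simp]: "u \<in> Obj V" "w \<in> Obj V" "X \<in> Obj V" "f \<in> Arr V"
    "Dom V f = k" "Cod V f = IHom V w (IHom V u X)"
  shows "(\<one> (u \<odot> w) \<otimes> f) \<cdot> (whisk u w (IHom V w (IHom V u X)) (\<epsilon> w (IHom V u X)) \<cdot> \<epsilon> u X)
    = whisk u w k ((\<one> w \<otimes> f) \<cdot> \<epsilon> w (IHom V u X)) \<cdot> \<epsilon> u X"
proof -
  have [simp]: "k \<in> Obj V"
    using Dom_obj[of f] by simp
  show ?thesis
    by (subst whisk_natural[symmetric, where k = k and k' = "IHom V w (IHom V u X)"]) simp_all
qed

lemma transpose_curry: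
  assumes [simp]: "u \<in> Obj V" "w \<in> Obj V" "X \<in> Obj V"
  shows "(\<one> (u \<odot> w) \<otimes> curry_arr u w X)
      \<cdot> (whisk u w (IHom V w (IHom V u X)) (\<epsilon> w (IHom V u X)) \<cdot> \<epsilon> u X)
    = \<epsilon> (u \<odot> w) X"
  by (subst whisk_transpose[where k = "IHom V (u \<odot> w) X"]) (simp_all add: curry_arr_def whisk_def)

text \<open>Two-stage evaluation detects equality: each stage is faithful by
  \<open>IHom_eqI\<close>, and the associator between them is invertible.\<close>

lemma IHom_IHom_eqI:
  assumes eq: "(\<one> (u \<odot> w) \<otimes> f) \<cdot> (whisk u w (IHom V w (IHom V u X)) (\<epsilon> w (IHom V u X)) \<cdot> \<epsilon> u X)
      = (\<one> (u \<odot> w) \<otimes> g) \<cdot> (whisk u w (IHom V w (IHom V u X)) (\<epsilon> w (IHom V u X)) \<cdot> \<epsilon> u X)"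
    and f [simp]: "f \<in> Arr V" "Dom V f = k" "Cod V f = IHom V w (IHom V u X)"
    and g [simp]: "g \<in> Arr V" "Dom V g = k" "Cod V g = IHom V w (IHom V u X)"
    and [simp]: "u \<in> Obj V" "w \<in> Obj V" "X \<in> Obj V"
  shows "f = g"
proof (rule IHom_eqI[of w f "IHom V u X"])
  have [simp]: "k \<in> Obj V"
    using Dom_obj[of f] by simp
  show "(\<one> w \<otimes> f) \<cdot> \<epsilon> w (IHom V u X) = (\<one> w \<otimes> g) \<cdot> \<epsilon> w (IHom V u X)"
  proof (rule IHom_eqI[of u _ X], rule epi_iso[of "\<alpha> u w k"])
    have "whisk u w k ((\<one> w \<otimes> f) \<cdot> \<epsilon> w (IHom V u X)) \<cdot> \<epsilon> u X
        = whisk u w k ((\<one> w \<otimes> g) \<cdot> \<epsilon> w (IHom V u X)) \<cdot> \<epsilon> u X"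
      using eq by (simp only: whisk_transpose[OF \<open>u \<in> Obj V\<close> \<open>w \<in> Obj V\<close> \<open>X \<in> Obj V\<close> f]
        whisk_transpose[OF \<open>u \<in> Obj V\<close> \<open>w \<in> Obj V\<close> \<open>X \<in> Obj V\<close> g])
    then show "\<alpha> u w k \<cdot> ((\<one> u \<otimes> ((\<one> w \<otimes> f) \<cdot> \<epsilon> w (IHom V u X))) \<cdot> \<epsilon> u X)
        = \<alpha> u w k \<cdot> ((\<one> u \<otimes> ((\<one> w \<otimes> g) \<cdot> \<epsilon> w (IHom V u X))) \<cdot> \<epsilon> u X)"
      by (simp add: whisk_def)
  qed (simp_all add: Assoc_iso)
qed simp_all

text \<open>Currying turns the two-stage evaluation into evaluation at u \<odot> w, and uncurrying
  does the reverse. Both composites therefore fix an evaluation that detects equality.\<close>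

lemma inverse_arrows_curry:
  assumes [simp]: "u \<in> Obj V" "w \<in> Obj V" "X \<in> Obj V"
  shows "inverse_arrows V (curry_arr u w X) (uncurry_arr u w X)"
proof -
  let ?c = "curry_arr u w X" and ?d = "uncurry_arr u w X"
  let ?K = "IHom V w (IHom V u X)"
  let ?t = "whisk u w ?K (\<epsilon> w (IHom V u X)) \<cdot> \<epsilon> u X"
  have "(\<one> (u \<odot> w) \<otimes> (?c \<cdot> ?d)) \<cdot> \<epsilon> (u \<odot> w) X = (\<one> (u \<odot> w) \<otimes> ?c) \<cdot> ((\<one> (u \<odot> w) \<otimes> ?d) \<cdot> \<epsilon> (u \<odot> w) X)"
    by (simp add: Ident_TArr_Comp)
  also have "\<dots> = \<epsilon> (u \<odot> w) X"
    by (simp only: transpose_uncurry transpose_curry assms)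
  finally have 1: "?c \<cdot> ?d = \<one> (IHom V (u \<odot> w) X)"
    by (intro IHom_eqI[of "u \<odot> w" "?c \<cdot> ?d" X "\<one> (IHom V (u \<odot> w) X)"]) simp_all
  have "(\<one> (u \<odot> w) \<otimes> (?d \<cdot> ?c)) \<cdot> ?t = (\<one> (u \<odot> w) \<otimes> ?d) \<cdot> ((\<one> (u \<odot> w) \<otimes> ?c) \<cdot> ?t)"
    by (simp add: Ident_TArr_Comp)
  also have "\<dots> = (\<one> (u \<odot> w) \<otimes> \<one> ?K) \<cdot> ?t"
    by (simp only: transpose_uncurry transpose_curry assms) simp
  finally have 2: "?d \<cdot> ?c = \<one> ?K"
    by (rule IHom_IHom_eqI[where k = ?K]) simp_all
  show ?thesis
    using 1 2 by (simp add: inverse_arrows_def Hom_def)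
qed

end


section \<open>Tensors in the completion\<close>

context closed_V_category
begin

text \<open>The action combines the enriched functor u \<odot> - on \<open>V\<close> with the
  passage from arrows x \<rightarrow> y of \<open>V\<close> to arrows a \<lhd> x \<rightarrow> a
  \<lhd> y, which composes them with the identity of a.\<close>

definition tensor_functor :: "'a \<Rightarrow> 'o \<Rightarrow> ('o, ('a, 'o) formal_tensor, 'm) vfunctor" where
  "tensor_functor a u =
    \<lparr> VFObj = (\<lambda>w. a \<lhd> (u \<odot> w)),
      VFArr = (\<lambda>w w'. Mate V (u \<odot> w) (IHom V w w') (VHom C a a \<odot> (u \<odot> w'))
        (whisk u w (IHom V w w') (\<epsilon> w w') \<cdot> (\<l>\<^sup>- (u \<odot> w') \<cdot> (VId C a \<otimes> \<one> (u \<odot> w'))))) \<rparr>"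

lemma tensor_functor_obj [simp]: "VFObj (tensor_functor a u) w = a \<lhd> (u \<odot> w)"
  by (simp add: tensor_functor_def)

lemma tensor_functor_simps [simp]:
  assumes "a \<in> VObj C" "u \<in> Obj V" "w \<in> Obj V" "w' \<in> Obj V"
  shows "VFArr (tensor_functor a u) w w' \<in> Arr V"
    "Dom V (VFArr (tensor_functor a u) w w') = IHom V w w'"
    "Cod V (VFArr (tensor_functor a u) w w') = IHom V (u \<odot> w) (VHom C a a \<odot> (u \<odot> w'))"
  using assms by (simp_all add: tensor_functor_def)

lemma transpose_tensor_functor:
  assumes "a \<in> VObj C" "u \<in> Obj V" "w \<in> Obj V" "w' \<in> Obj V"
  shows "(\<one> (u \<odot> w) \<otimes> VFArr (tensor_functor a u) w w') \<cdot> \<epsilon> (u \<odot> w) (VHom C a a \<odot> (u \<odot> w'))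
    = whisk u w (IHom V w w') (\<epsilon> w w') \<cdot> (\<l>\<^sup>- (u \<odot> w') \<cdot> (VId C a \<otimes> \<one> (u \<odot> w')))"
  using assms by (simp add: tensor_functor_def)

text \<open>Precomposing with an arrow in the image of the functor is plain precomposition in
  \<open>V\<close>, since \<open>whisk_act_VId\<close> removes the identity of a. No trace of
  composition in \<open>C\<close> is left.\<close>

lemma transpose_tensor_functor_ccomp:
  assumes [simp]: "a \<in> VObj C" "b \<in> VObj C" "u \<in> Obj V" "w \<in> Obj V" "w' \<in> Obj V" "v \<in> Obj V"
    "g \<in> Arr V" "Dom V g = k" "Cod V g = IHom V (u \<odot> w') (VHom C a b \<odot> v)"
  shows "(\<one> (u \<odot> w) \<otimes> ((VFArr (tensor_functor a u) w w' \<otimes> g)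
        \<cdot> ccomp (a \<lhd> (u \<odot> w)) (a \<lhd> (u \<odot> w')) (b \<lhd> v))) \<cdot> \<epsilon> (u \<odot> w) (VHom C a b \<odot> v)
    = tri (u \<odot> w) (IHom V w w') k (whisk u w (IHom V w w') (\<epsilon> w w'))
        ((\<one> (u \<odot> w') \<otimes> g) \<cdot> \<epsilon> (u \<odot> w') (VHom C a b \<odot> v))" (is "?lhs = ?rhs")
proof -
  have [simp]: "k \<in> Obj V"
    using Dom_obj[of g] by simp
  let ?h = "IHom V w w'" and ?g = "(\<one> (u \<odot> w') \<otimes> g) \<cdot> \<epsilon> (u \<odot> w') (VHom C a b \<odot> v)"
  let ?j = "\<l>\<^sup>- (u \<odot> w') \<cdot> (VId C a \<otimes> \<one> (u \<odot> w'))"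
  have "?lhs = tri (u \<odot> w) ?h k (whisk u w ?h (\<epsilon> w w') \<cdot> ?j)
      (whisk (VHom C a a) (u \<odot> w') k ?g \<cdot> act a a b v)"
    by (subst transpose_TArr_ccomp[where h = ?h and k = k])
      (simp_all add: transpose_tensor_functor)
  also have "\<dots> = tri (u \<odot> w) ?h k (whisk u w ?h (\<epsilon> w w'))
      ((?j \<otimes> \<one> k) \<cdot> (whisk (VHom C a a) (u \<odot> w') k ?g \<cdot> act a a b v))"
    by (rule tri_slide) simp_all
  also have "\<dots> = ?rhs"
    by (subst whisk_act_VId) simp_all
  finally show ?thesis .
qed

lemma V_functor_tensor_functor:
  assumes [simp]: "a \<in> VObj C" "u \<in> Obj V"
  shows "V_functor V (self_enrichment V) (completion V C) (tensor_functor a u)"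
proof (intro V_functor.intro V_functor_axioms.intro V_category_self_enrichment V_category_completion)
  fix w
  assume "w \<in> VObj (self_enrichment V)"
  then have [simp]: "w \<in> Obj V"
    by simp
  let ?L = "VFArr (tensor_functor a u) w w" and ?X = "VHom C a a \<odot> (u \<odot> w)"
  let ?j = "\<l>\<^sup>- (u \<odot> w) \<cdot> (VId C a \<otimes> \<one> (u \<odot> w))" and ?i = "VId (self_enrichment V) w"
  have "(\<one> (u \<odot> w) \<otimes> (?i \<cdot> ?L)) \<cdot> \<epsilon> (u \<odot> w) ?X
    = ((\<one> (u \<odot> w) \<otimes> ?i) \<cdot> whisk u w (IHom V w w) (\<epsilon> w w)) \<cdot> ?j"
    by (simp add: Ident_TArr_Comp transpose_tensor_functor)
  also have "\<dots> = whisk u w \<I> (\<r> w) \<cdot> ?j"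
    by (subst whisk_natural[where k = \<I>]) simp_all
  also have "\<dots> = (\<one> (u \<odot> w) \<otimes> VId (completion V C) (a \<lhd> (u \<odot> w))) \<cdot> \<epsilon> (u \<odot> w) ?X"
    by (subst transpose_completion_VId) (simp_all add: whisk_RUnit)
  finally have "?i \<cdot> ?L = VId (completion V C) (a \<lhd> (u \<odot> w))"
    by (rule IHom_eqI) simp_all
  then show "?i \<cdot> ?L = VId (completion V C) (VFObj (tensor_functor a u) w)"
    by simp
next
  fix w x y
  assume "w \<in> VObj (self_enrichment V)" "x \<in> VObj (self_enrichment V)" "y \<in> VObj (self_enrichment V)"
  then have [simp]: "w \<in> Obj V" "x \<in> Obj V" "y \<in> Obj V"
    by simp_all
  let ?L = "VFArr (tensor_functor a u)" and ?X = "VHom C a a \<odot> (u \<odot> y)"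
  let ?h = "IHom V w x" and ?k = "IHom V x y"
  let ?j = "\<l>\<^sup>- (u \<odot> y) \<cdot> (VId C a \<otimes> \<one> (u \<odot> y))"
  let ?R = "(?L w x \<otimes> ?L x y) \<cdot> ccomp (a \<lhd> (u \<odot> w)) (a \<lhd> (u \<odot> x)) (a \<lhd> (u \<odot> y))"
  have "(\<one> (u \<odot> w) \<otimes> (scomp w x y \<cdot> ?L w y)) \<cdot> \<epsilon> (u \<odot> w) ?X
    = ((\<one> (u \<odot> w) \<otimes> scomp w x y) \<cdot> whisk u w (IHom V w y) (\<epsilon> w y)) \<cdot> ?j"
    by (simp add: Ident_TArr_Comp transpose_tensor_functor)
  also have "\<dots> = whisk u w (?h \<odot> ?k) (tri w ?h ?k (\<epsilon> w x) (\<epsilon> x y)) \<cdot> ?j"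
    by (subst whisk_natural[where k = "?h \<odot> ?k"]) (simp_all add: transpose_scomp)
  also have "\<dots> = tri (u \<odot> w) ?h ?k (whisk u w ?h (\<epsilon> w x)) (whisk u x ?k (\<epsilon> x y) \<cdot> ?j)"
    by (subst whisk_tri[where w = x]) (simp_all add: tri_Comp)
  also have "\<dots> = (\<one> (u \<odot> w) \<otimes> ?R) \<cdot> \<epsilon> (u \<odot> w) ?X"
    by (subst transpose_tensor_functor_ccomp[where k = ?k]) (simp_all add: transpose_tensor_functor)
  finally have "scomp w x y \<cdot> ?L w y = ?R"
    by (rule IHom_eqI) simp_all
  then show "scomp w x y \<cdot> ?L w y = (?L w x \<otimes> ?L x y)
      \<cdot> ccomp (VFObj (tensor_functor a u) w) (VFObj (tensor_functor a u) x) (VFObj (tensor_functor a u) y)"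
    by simp
qed (simp_all add: Hom_def)

lemma closed_V_category_completion: "closed_V_category V (completion V C)"
  by (intro closed_V_category.intro V_category_completion) unfold_locales

lemma V_adjunction_tensor_functor:
  assumes [simp]: "a \<in> VObj C" "u \<in> Obj V"
  shows "V_adjunction V (self_enrichment V) (completion V C) (tensor_functor a u)
    (representable V (completion V C) (a \<lhd> u))
    (\<lambda>w x. curry_arr u w (case x of b \<lhd> v \<Rightarrow> VHom C a b \<odot> v))"
    (is "V_adjunction V ?S ?D ?L ?R ?\<theta>")
proof (intro V_adjunction.intro V_adjunction_axioms.intro)
  show "V_functor V ?S ?D ?L"
    by (simp add: V_functor_tensor_functor)
  show "V_functor V ?D ?S ?R"
    using closed_V_category.V_functor_representable[OF closed_V_category_completion] by simp
next
  fix w x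
  assume "w \<in> VObj ?S" "x \<in> VObj ?D"
  then obtain b v where x: "x = b \<lhd> v" and [simp]: "w \<in> Obj V" "b \<in> VObj C" "v \<in> Obj V"
    by (auto elim!: VObj_completionE)
  show "?\<theta> w x \<in> Hom V (VHom ?D (VFObj ?L w) x) (VHom ?S w (VFObj ?R x))"
    by (simp add: x Hom_def representable_def)
  show "iso_arr V (?\<theta> w x)"
    using inverse_arrows_curry[of u w "VHom C a b \<odot> v"] by (auto simp: x iso_arr_def)
next
  fix w w' x
  assume "w \<in> VObj ?S" "w' \<in> VObj ?S" "x \<in> VObj ?D"
  then obtain b v where x: "x = b \<lhd> v"
    and [simp]: "w \<in> Obj V" "w' \<in> Obj V" "b \<in> VObj C" "v \<in> Obj V"
    by (auto elim!: VObj_completionE)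
  let ?X = "VHom C a b \<odot> v"
  let ?U = "IHom V u ?X"
  let ?h = "IHom V w w'" and ?k = "IHom V w' ?U"
  let ?M = "ccomp (a \<lhd> (u \<odot> w)) (a \<lhd> (u \<odot> w')) (b \<lhd> v)"
  \<comment> \<open>The law for the inverse isomorphism concerns \<open>uncurry_arr\<close>, a mate
    over u \<odot> w, so one evaluation is enough below and \<open>whisk_tri\<close> finishes the
    comparison.\<close>
  have inv: "inv_arr V (curry_arr u y ?X) = uncurry_arr u y ?X" if "y \<in> Obj V" for y
    using that by (simp add: inv_arr_eqI inverse_arrows_curry)
  have "(\<one> (u \<odot> w) \<otimes> (scomp w w' ?U \<cdot> uncurry_arr u w ?X)) \<cdot> \<epsilon> (u \<odot> w) ?X
    = ((\<one> (u \<odot> w) \<otimes> scomp w w' ?U) \<cdot> whisk u w (IHom V w ?U) (\<epsilon> w ?U)) \<cdot> \<epsilon> u ?X"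
    by (simp add: Ident_TArr_Comp transpose_uncurry)
  also have "\<dots> = whisk u w (?h \<odot> ?k) (tri w ?h ?k (\<epsilon> w w') (\<epsilon> w' ?U)) \<cdot> \<epsilon> u ?X"
    by (subst whisk_natural[where k = "?h \<odot> ?k"]) (simp_all add: transpose_scomp)
  also have "\<dots> = tri (u \<odot> w) ?h ?k (whisk u w ?h (\<epsilon> w w')) (whisk u w' ?k (\<epsilon> w' ?U) \<cdot> \<epsilon> u ?X)"
    by (subst whisk_tri[where w = w']) (simp_all add: tri_Comp)
  also have "\<dots> = (\<one> (u \<odot> w) \<otimes> ((VFArr ?L w w' \<otimes> uncurry_arr u w' ?X) \<cdot> ?M)) \<cdot> \<epsilon> (u \<odot> w) ?X"
    by (subst transpose_tensor_functor_ccomp[where k = ?k]) (simp_all add: transpose_uncurry)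
  finally have "scomp w w' ?U \<cdot> uncurry_arr u w ?X = (VFArr ?L w w' \<otimes> uncurry_arr u w' ?X) \<cdot> ?M"
    by (rule IHom_eqI) simp_all
  then show "scomp w w' (VFObj ?R x) \<cdot> inv_arr V (?\<theta> w x)
      = (VFArr ?L w w' \<otimes> inv_arr V (?\<theta> w' x)) \<cdot> ccomp (VFObj ?L w) (VFObj ?L w') x"
    by (simp add: x inv representable_def)
next
  fix w x y
  assume "w \<in> VObj ?S" "x \<in> VObj ?D" "y \<in> VObj ?D"
  then obtain b v c z where xy: "x = b \<lhd> v" "y = c \<lhd> z"
    and [simp]: "w \<in> Obj V" "b \<in> VObj C" "v \<in> Obj V" "c \<in> VObj C" "z \<in> Obj V"
    by (auto elim!: VObj_completionE)
  let ?X = "VHom C a b \<odot> v" and ?Y = "VHom C a c \<odot> z"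
  let ?U = "IHom V u ?X" and ?W = "IHom V u ?Y"
  let ?h = "IHom V (u \<odot> w) ?X" and ?k = "IHom V v (VHom C b c \<odot> z)"
  let ?M = "ccomp (a \<lhd> u) (b \<lhd> v) (c \<lhd> z)"
  let ?N = "ccomp (a \<lhd> (u \<odot> w)) (b \<lhd> v) (c \<lhd> z)"
  let ?F = "Mate V ?U ?k ?W ?M"
  let ?G = "whisk (VHom C a b) v ?k (\<epsilon> v (VHom C b c \<odot> z)) \<cdot> act a b c z"
  let ?t = "\<lambda>X. whisk u w (IHom V w (IHom V u X)) (\<epsilon> w (IHom V u X)) \<cdot> \<epsilon> u X"
  let ?c = "\<lambda>X. curry_arr u w X"
  let ?P = "(?c ?X \<otimes> ?F) \<cdot> scomp w ?U ?W"
  \<comment> \<open>The associator in \<open>whisk\<close> cancels the inverse one in the transposed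
    composition, which frees the evaluation in u to slide to the first factor.\<close>
  have 1: "whisk u ?U ?k ?M \<cdot> \<epsilon> u ?Y = (\<epsilon> u ?X \<otimes> \<one> ?k) \<cdot> ?G"
    by (simp add: whisk_def transpose_ccomp tri_def)
  have 2: "whisk u w ?h ((\<one> w \<otimes> ?c ?X) \<cdot> \<epsilon> w ?U) \<cdot> \<epsilon> u ?X = \<epsilon> (u \<odot> w) ?X"
    by (subst whisk_transpose[symmetric]) (simp_all add: transpose_curry)
  have "(\<one> (u \<odot> w) \<otimes> ?P) \<cdot> ?t ?Y = whisk u w (?h \<odot> ?k) ((\<one> w \<otimes> ?P) \<cdot> \<epsilon> w ?W) \<cdot> \<epsilon> u ?Y"
    by (rule whisk_transpose) simp_all
  also have "(\<one> w \<otimes> ?P) \<cdot> \<epsilon> w ?W = tri w ?h ?k ((\<one> w \<otimes> ?c ?X) \<cdot> \<epsilon> w ?U) ?M"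
    by (subst transpose_TArr_scomp[where h = ?h and k = ?k]) simp_all
  also have "whisk u w (?h \<odot> ?k) \<dots> \<cdot> \<epsilon> u ?Y
      = tri (u \<odot> w) ?h ?k (whisk u w ?h ((\<one> w \<otimes> ?c ?X) \<cdot> \<epsilon> w ?U)) (whisk u ?U ?k ?M \<cdot> \<epsilon> u ?Y)"
    by (subst whisk_tri[where w = ?U]) (simp_all add: tri_Comp)
  \<comment> \<open>The evaluation in u joins the first factor and completes the two-stage
    evaluation of the curried arrow, which fact \<open>2\<close> identifies with evaluation at u
    \<odot> w. What remains is the transposed composition out of a \<lhd> (u \<odot> w).\<close>
  also have "\<dots> = tri (u \<odot> w) ?h ?k (whisk u w ?h ((\<one> w \<otimes> ?c ?X) \<cdot> \<epsilon> w ?U) \<cdot> \<epsilon> u ?X) ?G"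
    unfolding 1 by (rule tri_slide[symmetric]) simp_all
  also have "\<dots> = (\<one> (u \<odot> w) \<otimes> ?N) \<cdot> \<epsilon> (u \<odot> w) ?Y"
    unfolding 2 by (rule transpose_ccomp[symmetric]) simp_all
  also have "\<dots> = (\<one> (u \<odot> w) \<otimes> ?N) \<cdot> ((\<one> (u \<odot> w) \<otimes> ?c ?Y) \<cdot> ?t ?Y)"
    by (simp only: transpose_curry IHom_obj' TObj_obj VHom_obj' assms \<open>w \<in> Obj V\<close> \<open>c \<in> VObj C\<close> \<open>z \<in> Obj V\<close>)
  also have "\<dots> = (\<one> (u \<odot> w) \<otimes> (?N \<cdot> ?c ?Y)) \<cdot> ?t ?Y"
    by (simp add: Ident_TArr_Comp)
  finally have "?P = ?N \<cdot> ?c ?Y"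
    by (rule IHom_IHom_eqI[where k = "?h \<odot> ?k"]) simp_all
  then show "ccomp (VFObj ?L w) x y \<cdot> ?\<theta> w y
      = (?\<theta> w x \<otimes> VFArr ?R x y) \<cdot> scomp w (VFObj ?R x) (VFObj ?R y)"
    by (simp add: xy representable_def)
qed

lemma tensored_V_category_completion: "tensored_V_category V (completion V C)"
proof (intro tensored_V_category.intro tensored_V_category_axioms.intro V_category_completion)
  show "closed_monoidal_category V" ..
  fix x
  assume "x \<in> VObj (completion V C)"
  then show "has_left_V_adjoint V (self_enrichment V) (completion V C) (representable V (completion V C) x)"
    using V_adjunction_tensor_functor by (auto elim!: VObj_completionE simp: has_left_V_adjoint_def)
qed

end

theorem corollary5p4:
  fixes V :: "('o, 'm) closed_moncat"
    and C :: "('a, 'o, 'm) vcat"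
  assumes "closed_monoidal_category V"
    and "oplax_tensored_V_category V C"
  shows "tensored_V_category V (completion V C)"
  using assms
  by (intro closed_V_category.tensored_V_category_completion closed_V_category.intro
      oplax_tensored_V_category.axioms(1))

end
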